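(* Let $H=L^2(\mathbb R)$ (Lebesgue measure), let $D$ be the (unbounded) operator of multiplication by $t\mapsto e^t$, and for each integer $n\ge1$ let $E_n$ be the orthogonal projection onto the subspace of functions supported in $[-n,-n+1]\cup[n-1,n]$. For a positive bounded operator $T$ on $H$ define $\psi(T)=\sum_{n\ge1}\mathrm{Tr}(DE_nT)\in[0,\infty]$, where $\mathrm{Tr}(DE_nT)$ means $\mathrm{Tr}((DE_n)^{1/2}T(DE_n)^{1/2})$, and let $\mathcal M^+=\{T\in B(H)^+:\psi(T)<\infty\}$. Then there exist positive compact operators $S,T$ on $H$ with $S,T\in\mathcal M^+$ but $|S-T|\notin\mathcal M^+$.
   Context: Each $DE_n$ is a bounded positive operator commuting with $E_n$. $|X|=(X^*X)^{1/2}$. *)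

theory Defs
  imports "HOL-Analysis.Analysis"
begin

text \<open>Elements of H = L^2(R) (complex, Lebesgue measure) are represented by
  square-integrable functions real => complex, identified up to a.e. equality.
  Operators on H are represented by maps on such functions.\<close>

type_synonym L2fun = "real \<Rightarrow> complex"
type_synonym L2op = "L2fun \<Rightarrow> L2fun"

definition sq_int :: "L2fun \<Rightarrow> bool" where
  "sq_int f \<longleftrightarrow> f \<in> borel_measurable lebesgue \<and>
     integrable lebesgue (\<lambda>x. (cmod (f x))^2)"

definition ip :: "L2fun \<Rightarrow> L2fun \<Rightarrow> complex" where
  "ip f g = (LINT x|lebesgue. f x * cnj (g x))"

definition l2norm :: "L2fun \<Rightarrow> real" where
  "l2norm f = sqrt (LINT x|lebesgue. (cmod (f x))^2)"

definition bounded_op :: "L2op \<Rightarrow> bool" where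
  "bounded_op T \<longleftrightarrow>
     (\<forall>f. sq_int f \<longrightarrow> sq_int (T f)) \<and>
     (\<forall>f g a b. sq_int f \<longrightarrow> sq_int g \<longrightarrow>
        (AE x in lebesgue. T (\<lambda>t. a * f t + b * g t) x = a * T f x + b * T g x)) \<and>
     (\<exists>C. \<forall>f. sq_int f \<longrightarrow> l2norm (T f) \<le> C * l2norm f)"

definition positive_op :: "L2op \<Rightarrow> bool" where
  "positive_op T \<longleftrightarrow> bounded_op T \<and>
     (\<forall>f. sq_int f \<longrightarrow> Im (ip (T f) f) = 0 \<and> Re (ip (T f) f) \<ge> 0)"

definition compact_op :: "L2op \<Rightarrow> bool" where
  "compact_op T \<longleftrightarrow> bounded_op T \<and>
     (\<forall>(fs::nat \<Rightarrow> L2fun) (B::real). (\<forall>k. sq_int (fs k)) \<and> (\<forall>k. l2norm (fs k) \<le> B) \<longrightarrow>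
        (\<exists>(r::nat \<Rightarrow> nat) g. strict_mono r \<and> sq_int g \<and>
           (\<lambda>k. l2norm (\<lambda>t. T (fs (r k)) t - g t)) \<longlonglongrightarrow> 0))"

text \<open>Orthonormal basis of H (indexed by nat; H is separable and infinite-dimensional).\<close>
definition onb :: "(nat \<Rightarrow> L2fun) \<Rightarrow> bool" where
  "onb e \<longleftrightarrow> (\<forall>i. sq_int (e i)) \<and>
     (\<forall>i j. ip (e i) (e j) = (if i = j then 1 else 0)) \<and>
     (\<forall>f. sq_int f \<and> (\<forall>i. ip f (e i) = 0) \<longrightarrow> (AE x in lebesgue. f x = 0))"

definition trace_pos :: "L2op \<Rightarrow> ennreal" where
  "trace_pos P = (let e = (SOME e. onb e) in (\<Sum>i. ennreal (Re (ip (P (e i)) (e i)))))"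

definition Kset :: "nat \<Rightarrow> real set" where
  "Kset n = {- real n .. - real n + 1} \<union> {real n - 1 .. real n}"

text \<open>D: multiplication by e^t; E_n: multiplication by the indicator of Kset n
  (orthogonal projection onto functions supported in Kset n).\<close>
definition Dop :: "L2op" where
  "Dop f = (\<lambda>t. complex_of_real (exp t) * f t)"

definition Eop :: "nat \<Rightarrow> L2op" where
  "Eop n f = (\<lambda>t. complex_of_real (indicator (Kset n) t) * f t)"

text \<open>(D E_n)^{1/2}: D E_n is multiplication by e^t 1_{K_n}(t) >= 0, its positive
  square root is multiplication by e^{t/2} 1_{K_n}(t).\<close>
definition sqrtDE :: "nat \<Rightarrow> L2op" where
  "sqrtDE n f = (\<lambda>t. complex_of_real (indicator (Kset n) t * exp (t / 2)) * f t)"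

definition psi :: "L2op \<Rightarrow> ennreal" where
  "psi T = (\<Sum>n. trace_pos (sqrtDE (Suc n) \<circ> T \<circ> sqrtDE (Suc n)))"

definition in_Mplus :: "L2op \<Rightarrow> bool" where
  "in_Mplus T \<longleftrightarrow> positive_op T \<and> psi T < \<infinity>"

text \<open>A is |X| = (X^* X)^{1/2}: A positive with <A A f, g> = <X f, X g> = <X^* X f, g>.\<close>
definition is_abs_op :: "L2op \<Rightarrow> L2op \<Rightarrow> bool" where
  "is_abs_op A X \<longleftrightarrow> positive_op A \<and>
     (\<forall>f g. sq_int f \<longrightarrow> sq_int g \<longrightarrow> ip (A (A f)) g = ip (X f) (X g))"

end

theory Submission
  imports Defs
begin

text \<open>
  The operators are direct sums over the blocks \<open>K\<^sub>n = [-n, -n+1] \<union> [n-1, n]\<close>. Let \<open>v\<close> and \<open>u\<close> be the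
  indicators of the negative and the positive half of the block with index \<open>m = n - 1\<close>, so that \<open>D\<close> is
  of size \<open>e\<^sup>-\<^sup>m\<close> on \<open>v\<close> and of size \<open>e\<^sup>m\<close> on \<open>u\<close>. On this block \<open>S\<close> and \<open>T\<close> are
  the rank-one operators given by the vectors \<open>a v + b u\<close> and \<open>a v - b u\<close>, hence \<open>S - T\<close> is \<open>2 a b\<close> times
  the flip of \<open>u\<close> and \<open>v\<close>, and \<open>|S - T|\<close> acts as the scalar \<open>2 a b\<close> on the span of \<open>u\<close> and \<open>v\<close>.
  With \<open>a = exp (- m / 4)\<close> and \<open>b = exp (- 3 m / 4)\<close> the block contributes
  \<open>O(exp (- m / 2))\<close> to \<open>\<psi> S\<close> and \<open>\<psi> T\<close>, but at least \<open>2\<close> to \<open>\<psi> |S - T|\<close>.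

  The trace is evaluated in an arbitrary orthonormal basis by Parseval's identity, which rests on
  the Riesz-Fischer theorem; that there is an orthonormal basis at all follows from Zorn's lemma, since the
  rational intervals form a countable total family.
\<close>

subsection \<open>The inner product and the norm\<close>

lemma sq_int_integrable: "sq_int f \<Longrightarrow> integrable lebesgue (\<lambda>x. (cmod (f x))\<^sup>2)"
  by (simp add: sq_int_def)

lemma sq_int_bound:
  assumes "integrable lebesgue g" "f \<in> borel_measurable lebesgue" "\<And>x. (cmod (f x))\<^sup>2 \<le> g x"
  shows "sq_int f"
  unfolding sq_int_def
proof
  note [measurable] = assms(2)
  show "integrable lebesgue (\<lambda>x. (cmod (f x))\<^sup>2)"
    by (rule Bochner_Integration.integrable_bound[OF assms(1)]) (use assms(3) in \<open>auto intro!: AE_I2 order_trans[OF _ abs_ge_self]\<close>)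
qed fact

lemma sq_int_zero: "sq_int (\<lambda>x. 0)"
  by (simp add: sq_int_def)

lemma sq_int_scale: "sq_int f \<Longrightarrow> sq_int (\<lambda>x. c * f x)"
  by (auto simp: sq_int_def norm_mult power_mult_distrib)

lemma cmod_add_square_le: "(cmod (a + b))\<^sup>2 \<le> 2 * (cmod a)\<^sup>2 + 2 * (cmod b)\<^sup>2"
proof -
  have "(cmod (a + b))\<^sup>2 \<le> (cmod a + cmod b)\<^sup>2"
    by (intro power_mono norm_triangle_ineq) auto
  also have "\<dots> \<le> 2 * (cmod a)\<^sup>2 + 2 * (cmod b)\<^sup>2"
    using sum_squares_bound[of "cmod a" "cmod b"] by (simp add: power2_sum)
  finally show ?thesis .
qed

lemma sq_int_add:
  assumes "sq_int f" "sq_int g" shows "sq_int (\<lambda>x. f x + g x)"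
  by (rule sq_int_bound[of "\<lambda>x. 2 * (cmod (f x))\<^sup>2 + 2 * (cmod (g x))\<^sup>2"])
    (use assms in \<open>auto simp: sq_int_def intro: cmod_add_square_le\<close>)

lemma sq_int_diff:
  assumes "sq_int f" "sq_int g" shows "sq_int (\<lambda>x. f x - g x)"
  using sq_int_add[OF assms(1) sq_int_scale[OF assms(2), of "-1"]] by simp

lemma sq_int_sum:
  assumes "\<And>i. i \<in> I \<Longrightarrow> sq_int (f i)" shows "sq_int (\<lambda>x. \<Sum>i\<in>I. f i x)"
  using assms by (induction I rule: infinite_finite_induct) (auto intro: sq_int_zero sq_int_add)

lemma sq_int_mult_bounded:
  assumes f: "sq_int f" and m: "q \<in> borel_measurable lebesgue" and B: "\<And>x. cmod (q x) \<le> B"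
  shows "sq_int (\<lambda>x. q x * f x)"
proof (rule sq_int_bound[of "\<lambda>x. B\<^sup>2 * (cmod (f x))\<^sup>2"])
  show "(cmod (q x * f x))\<^sup>2 \<le> B\<^sup>2 * (cmod (f x))\<^sup>2" for x
    unfolding norm_mult power_mult_distrib by (intro mult_right_mono power_mono B) auto
  show "(\<lambda>x. q x * f x) \<in> borel_measurable lebesgue"
    using f m by (auto simp: sq_int_def)
qed (use f in \<open>auto simp: sq_int_def\<close>)

lemma sq_int_indicator:
  assumes "A \<in> lmeasurable" shows "sq_int (\<lambda>x. indicator A x)"
proof -
  have "(\<lambda>x. (cmod (indicator A x))\<^sup>2) = (indicat_real A)"
    by (auto simp: indicator_def)
  moreover have "(indicator A :: real \<Rightarrow> complex) \<in> borel_measurable lebesgue"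
    using assms by (auto intro: borel_measurable_indicator dest: fmeasurableD)
  ultimately show ?thesis
    using assms unfolding sq_int_def lmeasurable_iff_integrable by metis
qed

lemma ip_measurable:
  assumes "sq_int f" "sq_int g"
  shows "(\<lambda>x. f x * cnj (g x)) \<in> borel_measurable lebesgue"
  using assms unfolding sq_int_def
  by (intro borel_measurable_times borel_measurable_continuous_on[of cnj]) (auto intro!: continuous_intros)

lemma ip_integrable:
  assumes "sq_int f" "sq_int g"
  shows "integrable lebesgue (\<lambda>x. f x * cnj (g x))"
proof (rule Bochner_Integration.integrable_bound[of _ "\<lambda>x. (cmod (f x))\<^sup>2 + (cmod (g x))\<^sup>2"])
  show "integrable lebesgue (\<lambda>x. (cmod (f x))\<^sup>2 + (cmod (g x))\<^sup>2)"
    using assms by (auto simp: sq_int_def)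
  show "(\<lambda>x. f x * cnj (g x)) \<in> borel_measurable lebesgue"
    using assms by (rule ip_measurable)
  have "cmod a * cmod b \<le> (cmod a)\<^sup>2 + (cmod b)\<^sup>2" for a b
    using sum_squares_bound[of "cmod a" "cmod b"] mult_nonneg_nonneg[of "cmod a" "cmod b"]
    by (simp del: mult_nonneg_nonneg)
  then show "AE x in lebesgue. cmod (f x * cnj (g x)) \<le> norm ((cmod (f x))\<^sup>2 + (cmod (g x))\<^sup>2)"
    by (simp add: norm_mult)
qed

lemma ip_cnj: "cnj (ip f g) = ip g f"
  unfolding ip_def by (subst Bochner_Integration.integral_cnj[symmetric]) (simp add: mult.commute)

lemma ip_add_left: "\<lbrakk>sq_int f; sq_int g; sq_int h\<rbrakk> \<Longrightarrow> ip (\<lambda>x. f x + g x) h = ip f h + ip g h"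
  unfolding ip_def by (simp add: distrib_right ip_integrable)

lemma ip_diff_left: "\<lbrakk>sq_int f; sq_int g; sq_int h\<rbrakk> \<Longrightarrow> ip (\<lambda>x. f x - g x) h = ip f h - ip g h"
  unfolding ip_def by (simp add: left_diff_distrib ip_integrable)

lemma ip_scale_left: "ip (\<lambda>x. c * f x) h = c * ip f h"
  unfolding ip_def by (simp add: mult.assoc)

lemma ip_zero_left [simp]: "ip (\<lambda>x. 0) h = 0"
  unfolding ip_def by simp

lemma ip_sum_left:
  assumes "\<And>i. i \<in> I \<Longrightarrow> sq_int (f i)" "sq_int h"
  shows "ip (\<lambda>x. \<Sum>i\<in>I. f i x) h = (\<Sum>i\<in>I. ip (f i) h)"
  using assms by (induction I rule: infinite_finite_induct) (simp_all add: ip_add_left sq_int_sum)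

lemma ip_add_right: "\<lbrakk>sq_int f; sq_int g; sq_int h\<rbrakk> \<Longrightarrow> ip h (\<lambda>x. f x + g x) = ip h f + ip h g"
  by (metis (no_types, lifting) ip_add_left ip_cnj complex_cnj_add)

lemma ip_diff_right: "\<lbrakk>sq_int f; sq_int g; sq_int h\<rbrakk> \<Longrightarrow> ip h (\<lambda>x. f x - g x) = ip h f - ip h g"
  by (metis (no_types, lifting) ip_diff_left ip_cnj complex_cnj_diff)

lemma ip_scale_right: "ip h (\<lambda>x. c * f x) = cnj c * ip h f"
  by (metis (no_types, lifting) ip_scale_left ip_cnj complex_cnj_mult)

lemma ip_zero_right [simp]: "ip h (\<lambda>x. 0) = 0"
  unfolding ip_def by simp

lemma ip_sum_right:
  assumes "\<And>i. i \<in> I \<Longrightarrow> sq_int (f i)" "sq_int h"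
  shows "ip h (\<lambda>x. \<Sum>i\<in>I. f i x) = (\<Sum>i\<in>I. ip h (f i))"
  using assms by (induction I rule: infinite_finite_induct) (simp_all add: ip_add_right sq_int_sum)

lemma ip_cong_AE:
  assumes "AE x in lebesgue. f x = f' x" "sq_int f" "sq_int f'" "sq_int g"
  shows "ip f g = ip f' g"
  unfolding ip_def
  by (rule integral_cong_AE) (use assms in \<open>auto simp: ip_measurable\<close>)

lemma l2norm_nonneg [simp]: "0 \<le> l2norm f"
  unfolding l2norm_def by simp

lemma l2norm_power2: "(l2norm f)\<^sup>2 = (LINT x|lebesgue. (cmod (f x))\<^sup>2)"
  unfolding l2norm_def by simp

lemma ip_self: "ip f f = of_real ((l2norm f)\<^sup>2)"
  unfolding l2norm_power2 ip_def integral_complex_of_real[symmetric]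
  by (simp only: complex_norm_square)

lemma nn_integral_cmod_square:
  "sq_int f \<Longrightarrow> (\<integral>\<^sup>+x. ennreal ((cmod (f x))\<^sup>2) \<partial>lebesgue) = ennreal ((l2norm f)\<^sup>2)"
  unfolding l2norm_power2 by (intro nn_integral_eq_integral) (auto simp: sq_int_def)

lemma l2norm_eq_0_iff:
  assumes "sq_int f" shows "l2norm f = 0 \<longleftrightarrow> (AE x in lebesgue. f x = 0)"
proof -
  have "l2norm f = 0 \<longleftrightarrow> (LINT x|lebesgue. (cmod (f x))\<^sup>2) = 0"
    unfolding l2norm_def by simp
  also have "\<dots> \<longleftrightarrow> (AE x in lebesgue. f x = 0)"
    using assms by (subst integral_nonneg_eq_0_iff_AE) (auto simp: sq_int_def)
  finally show ?thesis .
qed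

lemma l2norm_scale: "l2norm (\<lambda>x. c * f x) = cmod c * l2norm f"
  unfolding l2norm_def by (simp add: norm_mult power_mult_distrib real_sqrt_mult)

lemma l2norm_cong_AE:
  assumes "AE x in lebesgue. f x = f' x" "sq_int f" "sq_int f'"
  shows "l2norm f = l2norm f'"
  unfolding l2norm_def
  by (rule arg_cong[where f=sqrt], rule integral_cong_AE) (use assms in \<open>auto simp: sq_int_def\<close>)

section \<open>Finite orthonormal systems: projections, Bessel's inequality, Cauchy-Schwarz\<close>

definition orthonormal :: "L2fun set \<Rightarrow> bool" where
  "orthonormal B \<longleftrightarrow> (\<forall>b\<in>B. sq_int b) \<and> (\<forall>b\<in>B. \<forall>c\<in>B. ip b c = (if b = c then 1 else 0))"

text \<open>With \<open>p\<close> the projection of \<open>f\<close>, the products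
  \<open>ip f p\<close>, \<open>ip p f\<close> and \<open>ip p p\<close> all equal the sum of the
  squared coefficients, so expanding the square leaves one copy with a minus sign. The family is
  indexed, so that the lemma serves both for sequences and for a set indexed by itself.\<close>

lemma l2norm_diff_projection:
  assumes "finite I" "\<And>i. i \<in> I \<Longrightarrow> sq_int (e i)"
    and on: "\<And>i j. i \<in> I \<Longrightarrow> j \<in> I \<Longrightarrow> ip (e i) (e j) = (if i = j then 1 else 0)"
    and f: "sq_int f"
  shows "(l2norm (\<lambda>x. f x - (\<Sum>i\<in>I. ip f (e i) * e i x)))\<^sup>2 = (l2norm f)\<^sup>2 - (\<Sum>i\<in>I. (cmod (ip f (e i)))\<^sup>2)"
proof -
  define p where "p = (\<lambda>x. \<Sum>i\<in>I. ip f (e i) * e i x)"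
  have e: "sq_int (\<lambda>x. c * e i x)" if "i \<in> I" for i c
    using that assms by (auto intro: sq_int_scale)
  have p: "sq_int p"
    unfolding p_def by (intro sq_int_sum e)
  have fp: "ip f p = (\<Sum>i\<in>I. of_real ((cmod (ip f (e i)))\<^sup>2))"
    unfolding p_def
    by (subst ip_sum_right[OF e f])
      (auto simp: ip_scale_right complex_norm_square simp del: of_real_power intro!: sum.cong)
  have pe: "ip p (e j) = ip f (e j)" if j: "j \<in> I" for j
  proof -
    have "ip p (e j) = (\<Sum>i\<in>I. if i = j then ip f (e i) else 0)"
      unfolding p_def by (subst ip_sum_left[OF e])
        (use j assms(2) in \<open>auto simp: ip_scale_left on intro!: sum.cong\<close>)
    with j assms(1) show ?thesis by simp
  qed
  have "ip p p = ip p (\<lambda>x. \<Sum>i\<in>I. ip f (e i) * e i x)" by (simp add: p_def)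
  also have "\<dots> = (\<Sum>i\<in>I. of_real ((cmod (ip f (e i)))\<^sup>2))"
    by (subst ip_sum_right[OF e p])
      (auto simp: ip_scale_right complex_norm_square pe simp del: of_real_power intro!: sum.cong)
  finally have pp: "ip p p = (\<Sum>i\<in>I. of_real ((cmod (ip f (e i)))\<^sup>2))" .
  have pf: "ip p f = (\<Sum>i\<in>I. of_real ((cmod (ip f (e i)))\<^sup>2))"
    using arg_cong[OF fp, of cnj] by (simp add: ip_cnj)
  have "of_real ((l2norm (\<lambda>x. f x - p x))\<^sup>2) = ip (\<lambda>x. f x - p x) (\<lambda>x. f x - p x)"
    by (simp add: ip_self)
  also have "\<dots> = ip f f - ip f p - ip p f + ip p p"
    using f p by (simp add: ip_diff_left ip_diff_right sq_int_diff)
  also have "\<dots> = of_real ((l2norm f)\<^sup>2 - (\<Sum>i\<in>I. (cmod (ip f (e i)))\<^sup>2))"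
    unfolding fp pf pp by (simp add: ip_self)
  finally show ?thesis
    unfolding p_def of_real_eq_iff .
qed

lemma bessel_finite:
  assumes "finite I" "\<And>i. i \<in> I \<Longrightarrow> sq_int (e i)"
    and "\<And>i j. i \<in> I \<Longrightarrow> j \<in> I \<Longrightarrow> ip (e i) (e j) = (if i = j then 1 else 0)"
    and "sq_int f"
  shows "(\<Sum>i\<in>I. (cmod (ip f (e i)))\<^sup>2) \<le> (l2norm f)\<^sup>2"
  using l2norm_diff_projection[OF assms] by (smt (verit) zero_le_power2)

lemma Cauchy_Schwarz_ip:
  assumes f: "sq_int f" and g: "sq_int g"
  shows "cmod (ip f g) \<le> l2norm f * l2norm g"
proof (cases "l2norm g = 0")
  case True
  then have "AE x in lebesgue. g x = 0" using l2norm_eq_0_iff[OF g] by simp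
  then have "ip g f = ip (\<lambda>x. 0) f" using f g by (intro ip_cong_AE) (auto intro: sq_int_zero)
  then show ?thesis using ip_cnj[of g f] by simp
next
  case False
  define c where "c = complex_of_real (1 / l2norm g)"
  define h where "h = (\<lambda>x. c * g x)"
  have h: "sq_int h" unfolding h_def by (intro sq_int_scale g)
  have hh: "ip h h = 1"
    using False unfolding h_def ip_self l2norm_scale by (simp add: c_def norm_divide)
  have "(cmod (ip f h))\<^sup>2 \<le> (l2norm f)\<^sup>2"
    \<comment> \<open>Bessel's inequality for the one-element system consisting of the normalised
      \<open>g\<close>.\<close>
    using bessel_finite[of "{()}" "\<lambda>_. h" f] h hh f by simp
  then have "cmod (ip f h) \<le> l2norm f"
    using power2_le_imp_le[OF _ l2norm_nonneg] by blast
  moreover have "cmod (ip f h) = cmod (ip f g) / l2norm g"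
    unfolding h_def ip_scale_right by (simp add: norm_mult c_def norm_divide)
  ultimately show ?thesis using False l2norm_nonneg[of g] by (simp add: divide_le_eq split: if_splits)
qed

subsection \<open>Completeness and Parseval's identity\<close>

text \<open>Square-integrability is a conclusion here: this is the form in which Fatou's lemma
  delivers its bound in the Riesz-Fischer theorem.\<close>

lemma l2norm_le_of_nn_integral:
  assumes f: "f \<in> borel_measurable lebesgue" and c: "0 \<le> c"
    and le: "(\<integral>\<^sup>+x. ennreal ((cmod (f x))\<^sup>2) \<partial>lebesgue) \<le> ennreal (c\<^sup>2)"
  shows "sq_int f" "l2norm f \<le> c"
proof -
  have "integrable lebesgue (\<lambda>x. (cmod (f x))\<^sup>2)"
  proof (rule integrableI_nonneg)
    show "(\<integral>\<^sup>+x. ennreal ((cmod (f x))\<^sup>2) \<partial>lebesgue) < \<infinity>"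
      using le by (rule order.strict_trans1) simp
  qed (use f in auto)
  with f show *: "sq_int f" by (simp add: sq_int_def)
  from le have "(l2norm f)\<^sup>2 \<le> c\<^sup>2"
    by (simp add: nn_integral_cmod_square[OF *])
  with c show "l2norm f \<le> c" by (rule power2_le_imp_le[rotated])
qed

text \<open>Weighting the squared increments by \<open>2^j\<close> still leaves a series with finite
  integral. Hence almost everywhere its terms tend to 0, the increments are eventually at most
  \<open>sqrt (1/2) ^ j\<close>, and the telescoping series converges by comparison with a geometric
  one.\<close>

lemma fast_Cauchy_AE_convergent:
  assumes s: "\<And>n. sq_int (s n)"
    and fast: "\<And>j. l2norm (\<lambda>x. s (Suc j) x - s j x) \<le> (1/2) ^ j"
  shows "AE x in lebesgue. convergent (\<lambda>j. s j x)"
proof -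
  define d where "d j x = s (Suc j) x - s j x" for j x
  have d: "sq_int (d j)" for j unfolding d_def by (intro sq_int_diff s)
  have [measurable]: "d j \<in> borel_measurable lebesgue" for j
    using d by (simp add: sq_int_def)
  have "(\<integral>\<^sup>+x. (\<Sum>j. ennreal (2^j * (cmod (d j x))\<^sup>2)) \<partial>lebesgue)
      = (\<Sum>j. \<integral>\<^sup>+x. ennreal (2^j * (cmod (d j x))\<^sup>2) \<partial>lebesgue)"
    by (intro nn_integral_suminf) measurable
  also have "\<dots> = (\<Sum>j. ennreal (2^j * (l2norm (d j))\<^sup>2))"
    by (simp add: ennreal_mult nn_integral_cmult nn_integral_cmod_square[OF d])
  also have "\<dots> \<le> (\<Sum>j. ennreal ((1/2)^j))"
  proof (intro suminf_le ennreal_leI)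
    fix j
    have "(l2norm (d j))\<^sup>2 \<le> ((1/2)^j)\<^sup>2"
      using fast[of j] by (intro power_mono) (auto simp: d_def[abs_def])
    then have "2^j * (l2norm (d j))\<^sup>2 \<le> 2^j * ((1/2)^j)\<^sup>2" by simp
    also have "\<dots> = (1/2)^j" by (simp add: power2_eq_square field_simps power_divide)
    finally show "2^j * (l2norm (d j))\<^sup>2 \<le> (1/2)^j" .
  qed auto
  also have "\<dots> = ennreal (\<Sum>j. (1/2)^j)"
    by (intro suminf_ennreal2) (auto intro: summable_geometric)
  finally have "(\<integral>\<^sup>+x. (\<Sum>j. ennreal (2^j * (cmod (d j x))\<^sup>2)) \<partial>lebesgue) \<noteq> \<infinity>"
    by (auto simp: top_unique)
  then have "AE x in lebesgue. (\<Sum>j. ennreal (2^j * (cmod (d j x))\<^sup>2)) \<noteq> \<infinity>"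
    by (intro nn_integral_PInf_AE) auto
  then show ?thesis
  proof (eventually_elim)
    case (elim x)
    then have "summable (\<lambda>j. 2^j * (cmod (d j x))\<^sup>2)"
      by (intro summable_suminf_not_top) auto
    then have "(\<lambda>j. 2^j * (cmod (d j x))\<^sup>2) \<longlonglongrightarrow> 0"
      by (rule summable_LIMSEQ_zero)
    then have "eventually (\<lambda>j. 2^j * (cmod (d j x))\<^sup>2 < 1) sequentially"
      by (rule order_tendstoD) simp
    then have "eventually (\<lambda>j. norm (d j x) \<le> (sqrt (1/2)) ^ j) sequentially"
    proof eventually_elim
      case (elim j)
      then have "(cmod (d j x))\<^sup>2 \<le> (1/2)^j"
        by (simp add: field_simps power_divide)
      also have "\<dots> = (sqrt (1/2) ^ j)\<^sup>2"
        by (simp add: power_mult[symmetric] mult.commute[of j]) (simp add: power_mult)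
      finally show ?case by (rule power2_le_imp_le) simp
    qed
    then have "summable (\<lambda>j. d j x)"
      by (rule summable_comparison_test_ev) (auto intro!: summable_geometric)
    then have "convergent (\<lambda>n. \<Sum>j<n. d j x)"
      by (simp add: summable_iff_convergent)
    moreover have "(\<Sum>j<n. d j x) = s n x - s 0 x" for n
      unfolding d_def by (rule sum_lessThan_telescope)
    ultimately have "convergent (\<lambda>n. s n x - s 0 x)" by simp
    then have "convergent (\<lambda>n. (s n x - s 0 x) + s 0 x)"
      by (intro convergent_add convergent_const)
    then show ?case by simp
  qed
qed

text \<open>A rapidly Cauchy subsequence has a pointwise limit \<open>g\<close> almost everywhere,
  and Fatou's lemma along this subsequence bounds the distance from \<open>s n\<close> to
  \<open>g\<close>.\<close>

theorem riesz_fischer: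
  assumes s: "\<And>n. sq_int (s n)"
    and Cauchy: "\<And>e. 0 < e \<Longrightarrow> \<exists>N. \<forall>m\<ge>N. \<forall>n\<ge>N. l2norm (\<lambda>x. s m x - s n x) < e"
  shows "\<exists>g. sq_int g \<and> (\<lambda>n. l2norm (\<lambda>x. s n x - g x)) \<longlonglongrightarrow> 0"
proof -
  have "\<exists>N. \<forall>m\<ge>N. \<forall>n\<ge>N. l2norm (\<lambda>x. s m x - s n x) < (1/2)^j" for j :: nat
    by (intro Cauchy) simp
  then obtain N where N: "\<And>j m n. m \<ge> N j \<Longrightarrow> n \<ge> N j \<Longrightarrow> l2norm (\<lambda>x. s m x - s n x) < (1/2)^j"
    by metis
  \<comment> \<open>The partial sums of \<open>Suc (N i)\<close> are strictly increasing and
    dominate \<open>N j\<close>.\<close>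
  define r where "r j = (\<Sum>i\<le>j. Suc (N i))" for j
  have mono: "strict_mono r" unfolding strict_mono_Suc_iff r_def by simp
  have rN: "N j \<le> r j" for j
    using member_le_sum[of j "{..j}" "\<lambda>i. Suc (N i)"] unfolding r_def by simp
  have "l2norm (\<lambda>x. s (r (Suc j)) x - s (r j) x) \<le> (1/2) ^ j" for j
    by (intro less_imp_le N rN order_trans[OF rN strict_mono_leD[OF mono]]) simp
  then have AE: "AE x in lebesgue. convergent (\<lambda>j. s (r j) x)"
    using fast_Cauchy_AE_convergent[of "\<lambda>j. s (r j)"] s by auto
  define g where "g x = lim (\<lambda>j. s (r j) x)" for x
  have [measurable]: "s n \<in> borel_measurable lebesgue" for n
    using s by (simp add: sq_int_def)
  have [measurable]: "g \<in> borel_measurable lebesgue"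
    unfolding g_def[abs_def] by measurable
  have lim: "AE x in lebesgue. (\<lambda>j. s (r j) x) \<longlonglongrightarrow> g x"
    using AE by eventually_elim (simp add: g_def convergent_LIMSEQ_iff)
  \<comment> \<open>The Fatou bound is stated for any \<open>n\<close> and threshold
    \<open>K\<close>: it is used once to obtain that \<open>g\<close> is square-integrable and once
    for the convergence.\<close>
  have close: "sq_int (\<lambda>x. s n x - g x) \<and> l2norm (\<lambda>x. s n x - g x) \<le> e"
    if e: "0 < e" and K: "\<And>m. m \<ge> K \<Longrightarrow> l2norm (\<lambda>x. s n x - s m x) < e" for n K e
  proof -
    have "(\<integral>\<^sup>+x. ennreal ((cmod (s n x - g x))\<^sup>2) \<partial>lebesgue)
        = (\<integral>\<^sup>+x. liminf (\<lambda>j. ennreal ((cmod (s n x - s (r j) x))\<^sup>2)) \<partial>lebesgue)"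
    proof (rule nn_integral_cong_AE, use lim in eventually_elim)
      case (elim x)
      have "(\<lambda>j. ennreal ((cmod (s n x - s (r j) x))\<^sup>2)) \<longlonglongrightarrow> ennreal ((cmod (s n x - g x))\<^sup>2)"
        by (intro tendsto_intros elim)
      then show ?case using lim_imp_Liminf[OF sequentially_bot] by metis
    qed
    also have "\<dots> \<le> liminf (\<lambda>j. \<integral>\<^sup>+x. ennreal ((cmod (s n x - s (r j) x))\<^sup>2) \<partial>lebesgue)"
      by (intro nn_integral_liminf) measurable
    also have "\<dots> = liminf (\<lambda>j. ennreal ((l2norm (\<lambda>x. s n x - s (r j) x))\<^sup>2))"
      by (simp add: nn_integral_cmod_square sq_int_diff s)
    also have "\<dots> \<le> liminf (\<lambda>j::nat. ennreal (e\<^sup>2))"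
    proof (rule Liminf_mono)
      have "\<forall>\<^sub>F j in sequentially. r j \<ge> K"
        using filterlim_subseq[OF mono] by (simp add: filterlim_at_top)
      then show "\<forall>\<^sub>F j in sequentially. ennreal ((l2norm (\<lambda>x. s n x - s (r j) x))\<^sup>2) \<le> ennreal (e\<^sup>2)"
        by eventually_elim (auto intro!: ennreal_leI power_mono intro: less_imp_le K)
    qed
    finally have "(\<integral>\<^sup>+x. ennreal ((cmod (s n x - g x))\<^sup>2) \<partial>lebesgue) \<le> ennreal (e\<^sup>2)"
      by (simp add: Liminf_const)
    then show ?thesis
      using e by (intro conjI l2norm_le_of_nn_integral) auto
  qed
  obtain K where K: "\<And>m n. m \<ge> K \<Longrightarrow> n \<ge> K \<Longrightarrow> l2norm (\<lambda>x. s m x - s n x) < 1"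
    using Cauchy[of 1] by auto
  have "sq_int (\<lambda>x. s K x - g x)" using close[of 1 K K] K by auto
  from sq_int_diff[OF s[of K] this] have "sq_int g" by simp
  moreover have "(\<lambda>n. l2norm (\<lambda>x. s n x - g x)) \<longlonglongrightarrow> 0"
  proof (rule LIMSEQ_I)
    fix e :: real assume e: "0 < e"
    obtain K where K: "\<And>m n. m \<ge> K \<Longrightarrow> n \<ge> K \<Longrightarrow> l2norm (\<lambda>x. s m x - s n x) < e/2"
      using Cauchy[of "e/2"] e by auto
    have "l2norm (\<lambda>x. s n x - g x) \<le> e/2" if "n \<ge> K" for n
      using close[of "e/2" K n] K that e by auto
    then show "\<exists>K. \<forall>n\<ge>K. norm (l2norm (\<lambda>x. s n x - g x) - 0) < e"
      using e by (intro exI[of _ K]) force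
  qed
  ultimately show ?thesis by blast
qed

text \<open>Bessel's inequality makes the Fourier partial sums \<open>p n\<close> a Cauchy sequence.
  Their limit \<open>g\<close> has the same coefficients as \<open>h\<close>, so
  \<open>h = g\<close> almost everywhere by totality of the basis, and the remainder in the
  projection formula tends to 0.\<close>

theorem parseval:
  assumes e: "onb e" and h: "sq_int h"
  shows "(\<lambda>i. (cmod (ip h (e i)))\<^sup>2) sums (l2norm h)\<^sup>2"
proof -
  have se: "sq_int (e i)" for i using e by (simp add: onb_def)
  have on: "ip (e i) (e j) = (if i = j then 1 else 0)" for i j using e by (simp add: onb_def)
  define a where "a i = (cmod (ip h (e i)))\<^sup>2" for i
  define p where "p n x = (\<Sum>i<n. ip h (e i) * e i x)" for n x
  have sp: "sq_int (p n)" for n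
    unfolding p_def by (intro sq_int_sum sq_int_scale se)
  have pe: "ip (p n) (e i) = (if i < n then ip h (e i) else 0)" for n i
    unfolding p_def
    by (subst ip_sum_left[OF sq_int_scale[OF se] se]) (simp add: ip_scale_left on if_distrib cong: if_cong)
  have hp: "(l2norm (\<lambda>x. h x - p n x))\<^sup>2 = (l2norm h)\<^sup>2 - (\<Sum>i<n. a i)" for n
    unfolding p_def a_def by (intro l2norm_diff_projection se on h) simp
  \<comment> \<open>For \<open>m \<le> n\<close> the partial sum \<open>p m\<close> is itself the
    projection of \<open>p n\<close>, so the projection formula applies again.\<close>
  have pm: "(l2norm (\<lambda>x. p n x - p m x))\<^sup>2 = (l2norm (p n))\<^sup>2 - (\<Sum>i<m. a i)" if "m \<le> n" for n m
  proof -
    have "(l2norm (\<lambda>x. p n x - (\<Sum>i<m. ip (p n) (e i) * e i x)))\<^sup>2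
        = (l2norm (p n))\<^sup>2 - (\<Sum>i<m. (cmod (ip (p n) (e i)))\<^sup>2)"
      by (intro l2norm_diff_projection se on sp) simp
    then show ?thesis using that by (simp add: pe p_def[of m] a_def)
  qed
  have pp: "(l2norm (p n))\<^sup>2 = (\<Sum>i<n. a i)" for n
    using pm[of n n] by (simp add: l2norm_power2)
  have "summable a"
  proof (rule summableI_nonneg_bounded)
    show "(\<Sum>i<n. a i) \<le> (l2norm h)\<^sup>2" for n
      using hp[of n] by (smt (verit) zero_le_power2)
  qed (simp add: a_def)
  then have "Cauchy (\<lambda>n. \<Sum>i<n. a i)"
    by (simp add: summable_iff_convergent Cauchy_convergent_iff)
  have "\<exists>g. sq_int g \<and> (\<lambda>n. l2norm (\<lambda>x. p n x - g x)) \<longlonglongrightarrow> 0"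
  proof (rule riesz_fischer[OF sp])
    fix \<epsilon> :: real assume \<epsilon>: "0 < \<epsilon>"
    with \<open>Cauchy _\<close> obtain N where N: "\<And>m n. m \<ge> N \<Longrightarrow> n \<ge> N \<Longrightarrow> \<bar>(\<Sum>i<m. a i) - (\<Sum>i<n. a i)\<bar> < \<epsilon>\<^sup>2"
      unfolding Cauchy_iff real_norm_def by (meson zero_less_power)
    have *: "l2norm (\<lambda>x. p n x - p m x) < \<epsilon>" if "m \<ge> N" "n \<ge> N" "m \<le> n" for m n
    proof (rule power2_less_imp_less)
      show "(l2norm (\<lambda>x. p n x - p m x))\<^sup>2 < \<epsilon>\<^sup>2"
        using N[OF that(2,1)] pm[OF that(3)] pp[of n] by linarith
    qed (use \<epsilon> in simp)
    have sym: "l2norm (\<lambda>x. p n x - p m x) = l2norm (\<lambda>x. p m x - p n x)" for m n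
      unfolding l2norm_def by (simp add: norm_minus_commute)
    show "\<exists>N. \<forall>m\<ge>N. \<forall>n\<ge>N. l2norm (\<lambda>x. p m x - p n x) < \<epsilon>"
    proof (intro exI[of _ N] allI impI)
      fix m n assume "m \<ge> N" "n \<ge> N"
      then show "l2norm (\<lambda>x. p m x - p n x) < \<epsilon>"
        using *[of m n] *[of n m] sym[of m n] by (cases "m \<le> n") auto
    qed
  qed
  then obtain g where g: "sq_int g" and lim: "(\<lambda>n. l2norm (\<lambda>x. p n x - g x)) \<longlonglongrightarrow> 0" by blast
  have "ip (\<lambda>x. h x - g x) (e i) = 0" for i
  proof -
    have "(\<lambda>n. ip (\<lambda>x. p n x - g x) (e i)) \<longlonglongrightarrow> 0"
    proof (rule Lim_null_comparison[OF _ lim])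
      have "l2norm (e i) = 1"
        using on[of i i] ip_self[of "e i"] l2norm_nonneg[of "e i"]
        by (metis of_real_eq_1_iff power2_eq_1_iff not_one_le_zero neg_0_le_iff_le order_trans zero_le_one)
      then show "\<forall>\<^sub>F n in sequentially. cmod (ip (\<lambda>x. p n x - g x) (e i)) \<le> l2norm (\<lambda>x. p n x - g x)"
        using Cauchy_Schwarz_ip[OF sq_int_diff[OF sp g] se[of i]] by simp
    qed
    moreover have "\<forall>\<^sub>F n in sequentially. ip (\<lambda>x. p n x - g x) (e i) = ip (\<lambda>x. h x - g x) (e i)"
      using eventually_gt_at_top[of i]
      by eventually_elim (simp add: ip_diff_left sp g se h pe)
    ultimately have "(\<lambda>n::nat. ip (\<lambda>x. h x - g x) (e i)) \<longlonglongrightarrow> 0"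
      by (rule Lim_transform_eventually)
    then show ?thesis by (simp add: LIMSEQ_const_iff)
  qed
  then have "AE x in lebesgue. h x - g x = 0"
    using e sq_int_diff[OF h g] unfolding onb_def by blast
  then have hg: "AE x in lebesgue. p n x - g x = (-1) * (h x - p n x)" for n
    by eventually_elim simp
  have "l2norm (\<lambda>x. p n x - g x) = l2norm (\<lambda>x. h x - p n x)" for n
    using l2norm_cong_AE[OF hg sq_int_diff[OF sp g] sq_int_scale[OF sq_int_diff[OF h sp]], of n]
    by (simp only: l2norm_scale) simp
  then have "(\<lambda>n. (l2norm (\<lambda>x. h x - p n x))\<^sup>2) \<longlonglongrightarrow> 0"
    using tendsto_power[OF lim, of 2] by simp
  then have "(\<lambda>n. (l2norm h)\<^sup>2 - (l2norm (\<lambda>x. h x - p n x))\<^sup>2) \<longlonglongrightarrow> (l2norm h)\<^sup>2 - 0"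
    by (intro tendsto_intros)
  then show ?thesis
    unfolding sums_def hp by (simp add: a_def)
qed

subsection \<open>Existence of an orthonormal basis\<close>

lemma ip_indicator_right: "ip f (indicator A) = (LINT x:A|lebesgue. f x)"
  unfolding ip_def set_lebesgue_integral_def
  by (rule Bochner_Integration.integral_cong) (auto simp: indicator_def)

lemma ip_indicator_indicator:
  assumes "A \<in> sets lebesgue" "B \<in> sets lebesgue"
  shows "ip (indicator A) (indicator B) = of_real (measure lebesgue (A \<inter> B))"
proof -
  have "ip (indicator A) (indicator B) = (LINT x|lebesgue. complex_of_real (indicat_real (A \<inter> B) x))"
    unfolding ip_def by (rule Bochner_Integration.integral_cong) (auto simp: indicator_def)
  also have "\<dots> = of_real (measure lebesgue (A \<inter> B))"
    unfolding integral_complex_of_real using assms by (simp add: sets.Int)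
  finally show ?thesis .
qed

lemma sq_int_integrable_on_interval:
  assumes f: "sq_int f"
  shows "f integrable_on {a..b}" "integral {a..b} f = ip f (indicator {a..b})"
proof -
  have "integrable lebesgue (\<lambda>x. f x * cnj (indicator {a..b} x))"
    by (intro ip_integrable f sq_int_indicator) simp
  also have "(\<lambda>x. f x * cnj (indicator {a..b} x)) = (\<lambda>x. indicat_real {a..b} x *\<^sub>R f x)"
    by (auto simp: indicator_def)
  finally have *: "set_integrable lebesgue {a..b} f"
    by (simp add: set_integrable_def)
  show "f integrable_on {a..b}" "integral {a..b} f = ip f (indicator {a..b})"
    using set_lebesgue_integral_eq_integral[OF *] by (simp_all add: ip_indicator_right)
qed

lemma lmeasurable_Ico: "{a..<b::real} \<in> lmeasurable"
  by (intro bounded_set_imp_lmeasurable) auto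

text \<open>The integral depends continuously on its endpoints, so it vanishes over all intervals
  and not only the rational ones. Lebesgue differentiation then recovers \<open>f\<close> almost
  everywhere as a limit of zero averages.\<close>

lemma rational_intervals_total:
  assumes f: "sq_int f"
    and orth: "\<And>a b. a \<in> \<rat> \<Longrightarrow> b \<in> \<rat> \<Longrightarrow> ip f (indicator {a..b}) = 0"
  shows "AE x in lebesgue. f x = 0"
proof -
  have zero: "integral {a..b} f = 0" if "a \<le> b" for a b
  proof (rule ccontr)
    assume nz: "integral {a..b} f \<noteq> 0"
    obtain \<delta> where \<delta>: "0 < \<delta>" and
      close: "\<And>c' d'. \<lbrakk>c' \<in> cbox (a-1) (b+1); d' \<in> cbox (a-1) (b+1); norm (c' - a) \<le> \<delta>; norm (d' - b) \<le> \<delta>\<rbrakk>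
        \<Longrightarrow> norm (integral (cbox c' d') f - integral (cbox a b) f) < norm (integral {a..b} f)"
      by (rule indefinite_integral_continuous[of f "a-1" "b+1" a b "norm (integral {a..b} f)"])
        (use sq_int_integrable_on_interval(1)[OF f, of "a-1" "b+1"] that nz in auto)
    \<comment> \<open>The cap by 1 keeps the rational endpoints inside the interval from
      \<open>a-1\<close> to \<open>b+1\<close>, on which the continuity estimate was taken.\<close>
    obtain c where c: "c \<in> \<rat>" "a < c" "c < a + min \<delta> 1" using Rats_dense_in_real[of a "a + min \<delta> 1"] \<delta> by auto
    obtain d where d: "d \<in> \<rat>" "b < d" "d < b + min \<delta> 1" using Rats_dense_in_real[of b "b + min \<delta> 1"] \<delta> by auto
    have "integral {c..d} f = 0"
      using orth[OF c(1) d(1)] sq_int_integrable_on_interval(2)[OF f] by simp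
    then show False
      using close[of c d] c d that by (auto simp: min_def split: if_splits)
  qed
  obtain N where N: "negligible N" and
    der: "\<And>x e. \<lbrakk>x \<notin> N; 0 < e\<rbrakk> \<Longrightarrow> \<exists>d>0. \<forall>h. 0 < h \<and> h < d \<longrightarrow>
       norm (integral (cbox x (x + h *\<^sub>R One)) f /\<^sub>R h ^ DIM(real) - f x) < e"
    using integrable_ccontinuous_explicit[of f] sq_int_integrable_on_interval(1)[OF f] by auto
  have "f x = 0" if x: "x \<notin> N" for x
  proof (rule ccontr)
    assume "f x \<noteq> 0"
    then obtain d where "d > 0" and d: "\<And>h. 0 < h \<Longrightarrow> h < d \<Longrightarrow>
        norm (integral {x..x + h} f /\<^sub>R h - f x) < norm (f x)"
      using der[OF x, of "norm (f x)"] by auto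
    show False using d[of "d/2"] \<open>d > 0\<close> zero[of x "x + d/2"] by simp
  qed
  then show ?thesis
    using N by (intro AE_I'[of N]) (auto simp: negligible_iff_null_sets)
qed

text \<open>Bessel's inequality bounds all finite sums of the squared coefficients, and a summable
  family has countable support.\<close>

lemma countable_nonzero_coefficients:
  assumes B: "orthonormal B" and f: "sq_int f"
  shows "countable {b\<in>B. ip f b \<noteq> 0}"
proof -
  have "(\<lambda>b. (cmod (ip f b))\<^sup>2) summable_on B"
  proof (rule nonneg_bdd_above_summable_on)
    show "bdd_above (sum (\<lambda>b. (cmod (ip f b))\<^sup>2) ` {F. F \<subseteq> B \<and> finite F})"
    proof (rule bdd_aboveI2)
      fix F assume "F \<in> {F. F \<subseteq> B \<and> finite F}"
      then show "(\<Sum>b\<in>F. (cmod (ip f b))\<^sup>2) \<le> (l2norm f)\<^sup>2"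
        using B f by (intro bessel_finite[of F "\<lambda>b. b"]) (auto simp: orthonormal_def subset_iff)
    qed
  qed simp
  then have "countable {b\<in>B. (cmod (ip f b))\<^sup>2 \<noteq> 0}"
    by (rule summable_countable_real)
  then show ?thesis by simp
qed

text \<open>A nonzero \<open>f\<close> orthogonal to \<open>B\<close> could be normalised and
  adjoined to \<open>B\<close>.\<close>

lemma maximal_orthonormal_total:
  assumes B: "orthonormal B" and max: "\<And>C. orthonormal C \<Longrightarrow> B \<subseteq> C \<Longrightarrow> C = B"
    and f: "sq_int f" and orth: "\<And>b. b \<in> B \<Longrightarrow> ip f b = 0"
  shows "AE x in lebesgue. f x = 0"
proof (rule ccontr)
  assume "\<not> (AE x in lebesgue. f x = 0)"
  then have nz: "l2norm f \<noteq> 0" using l2norm_eq_0_iff[OF f] by simp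
  define h where "h = (\<lambda>x. complex_of_real (1 / l2norm f) * f x)"
  have h: "sq_int h" unfolding h_def by (intro sq_int_scale f)
  have hh: "ip h h = 1"
    using nz unfolding h_def ip_self l2norm_scale by (simp add: norm_divide)
  have hb: "ip h b = 0" if "b \<in> B" for b
    using orth[OF that] unfolding h_def ip_scale_left by simp
  have bh: "ip b h = 0" if "b \<in> B" for b
    using hb[OF that] ip_cnj[of h b] by simp
  have "orthonormal (insert h B)"
    using B h hh hb bh by (auto simp: orthonormal_def)
  from max[OF this] have "h \<in> B" by blast
  with hb hh show False by force
qed

text \<open>A maximal orthonormal set is total. Since \<open>onb\<close> demands an enumeration by
  the natural numbers, the set must in addition be shown to be countable and infinite.\<close>

lemma exists_onb: "\<exists>e. onb e"
proof -
  have "\<exists>B\<in>Collect orthonormal. \<forall>C\<in>Collect orthonormal. B \<subseteq> C \<longrightarrow> C = B"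
  proof (rule subset_Zorn_nonempty)
    show "Collect orthonormal \<noteq> {}" by (auto intro: exI[of _ "{}"] simp: orthonormal_def)
    fix \<C> assume "subset.chain (Collect orthonormal) \<C>"
    then have \<C>: "\<And>C. C \<in> \<C> \<Longrightarrow> orthonormal C"
      and chain: "\<And>C D. C \<in> \<C> \<Longrightarrow> D \<in> \<C> \<Longrightarrow> C \<subseteq> D \<or> D \<subseteq> C"
      unfolding subset.chain_def by blast+
    show "\<Union>\<C> \<in> Collect orthonormal"
      unfolding orthonormal_def mem_Collect_eq
    proof (intro conjI ballI)
      fix b assume "b \<in> \<Union>\<C>" then show "sq_int b" using \<C> by (auto simp: orthonormal_def)
    next
      fix b c assume "b \<in> \<Union>\<C>" "c \<in> \<Union>\<C>"
      then obtain C D where "C \<in> \<C>" "b \<in> C" "D \<in> \<C>" "c \<in> D" by blast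
      with chain[of C D] obtain E where "E \<in> \<C>" "b \<in> E" "c \<in> E" by blast
      then show "ip b c = (if b = c then 1 else 0)" using \<C>[of E] by (simp add: orthonormal_def)
    qed
  qed
  then obtain B where B: "orthonormal B" and max: "\<And>C. orthonormal C \<Longrightarrow> B \<subseteq> C \<Longrightarrow> C = B" by auto
  note total = maximal_orthonormal_total[OF B max]
  \<comment> \<open>Each member of \<open>B\<close> has a nonzero product with some rational
    interval by totality, while each interval meets only countably many members in this way.\<close>
  have "B \<subseteq> (\<Union>(a,b)\<in>\<rat> \<times> \<rat>. {c\<in>B. ip (indicator {a..b}) c \<noteq> 0})"
  proof
    fix c assume c: "c \<in> B"
    then have cc: "sq_int c" "ip c c = 1" using B by (auto simp: orthonormal_def)
    have "\<exists>a\<in>\<rat>. \<exists>b\<in>\<rat>. ip c (indicator {a..b}) \<noteq> 0"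
    proof (rule ccontr)
      assume "\<not> ?thesis"
      then have "AE x in lebesgue. c x = 0" by (intro rational_intervals_total cc) auto
      then have "l2norm c = 0" using l2norm_eq_0_iff cc by simp
      with cc show False by (simp add: ip_self)
    qed
    then obtain a b where ab: "a \<in> \<rat>" "b \<in> \<rat>" "ip c (indicator {a..b}) \<noteq> 0" by blast
    then have "ip (indicator {a..b}) c \<noteq> 0"
      using ip_cnj[of c "indicator {a..b}"] by (metis complex_cnj_zero_iff)
    with ab c show "c \<in> (\<Union>(a,b)\<in>\<rat> \<times> \<rat>. {c\<in>B. ip (indicator {a..b}) c \<noteq> 0})" by blast
  qed
  moreover have "countable (\<Union>(a,b)\<in>\<rat> \<times> \<rat>. {c\<in>B. ip (indicator {a..b}) c \<noteq> 0})"
    by (auto intro!: countable_UN countable_SIGMA countable_rat countable_nonzero_coefficients[OF B] sq_int_indicator)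
  ultimately have cB: "countable B" by (rule countable_subset)
  have iB: "infinite B"
  proof
    assume fin: "finite B"
    define u :: "nat \<Rightarrow> L2fun" where "u n = indicator {real n..<real n + 1}" for n
    have u: "sq_int (u n)" for n unfolding u_def by (intro sq_int_indicator lmeasurable_Ico)
    have uu: "ip (u n) (u m) = (if n = m then 1 else 0)" for n m
    proof -
      have "{real n..<real n + 1} \<inter> {real m..<real m + 1} = {}" if "n \<noteq> m"
        using that by (auto simp: not_less)
      then show ?thesis unfolding u_def by (subst ip_indicator_indicator) auto
    qed
    have sb: "sq_int b" if "b \<in> B" for b using that B by (simp add: orthonormal_def)
    have norm1: "(l2norm f)\<^sup>2 = 1" if "ip f f = 1" for f
      using that unfolding ip_self of_real_eq_1_iff .
    have exact: "(\<Sum>b\<in>B. (cmod (ip (u n) b))\<^sup>2) = 1" for n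
    proof -
      define d where "d x = u n x - (\<Sum>b\<in>B. ip (u n) b * b x)" for x
      have d: "sq_int d" unfolding d_def by (intro sq_int_diff u sq_int_sum sq_int_scale sb)
      have "ip d b = 0" if b: "b \<in> B" for b
      proof -
        have "ip (\<lambda>x. \<Sum>c\<in>B. ip (u n) c * c x) b = (\<Sum>c\<in>B. if c = b then ip (u n) c else 0)"
          by (subst ip_sum_left[OF sq_int_scale[OF sb] sb[OF b]])
            (use b B in \<open>auto simp: ip_scale_left orthonormal_def intro!: sum.cong\<close>)
        also have "\<dots> = ip (u n) b" using b fin by simp
        finally show ?thesis
          unfolding d_def by (subst ip_diff_left) (auto intro!: u sb b sq_int_sum sq_int_scale)
      qed
      then have "AE x in lebesgue. d x = 0" by (intro total d)
      then have "l2norm d = 0" using l2norm_eq_0_iff[OF d] by simp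
      moreover have "(l2norm d)\<^sup>2 = (l2norm (u n))\<^sup>2 - (\<Sum>b\<in>B. (cmod (ip (u n) b))\<^sup>2)"
        unfolding d_def using B by (intro l2norm_diff_projection[of B "\<lambda>b. b"] fin u) (auto simp: orthonormal_def)
      ultimately show ?thesis using norm1[of "u n"] uu by simp
    qed
    \<comment> \<open>Double counting: each of the \<open>card B + 1\<close> orthonormal vectors
      \<open>u n\<close> has total weight 1 over \<open>B\<close>, yet by Bessel's inequality each
      \<open>b\<close> receives at most 1.\<close>
    have "real (Suc (card B)) = (\<Sum>n\<le>card B. \<Sum>b\<in>B. (cmod (ip (u n) b))\<^sup>2)"
      by (simp add: exact)
    also have "\<dots> = (\<Sum>b\<in>B. \<Sum>n\<le>card B. (cmod (ip b (u n)))\<^sup>2)"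
      by (subst sum.swap) (simp add: ip_cnj[symmetric, of "u _"])
    also have "\<dots> \<le> (\<Sum>b\<in>B. 1)"
    proof (rule sum_mono)
      fix b assume b: "b \<in> B"
      have "(\<Sum>n\<le>card B. (cmod (ip b (u n)))\<^sup>2) \<le> (l2norm b)\<^sup>2"
        by (intro bessel_finite u uu sb b) simp
      also have "\<dots> = 1" using norm1[of b] b B by (simp add: orthonormal_def)
      finally show "(\<Sum>n\<le>card B. (cmod (ip b (u n)))\<^sup>2) \<le> 1" .
    qed
    finally show False by simp
  qed
  define e where "e = from_nat_into B"
  have bij: "bij_betw e UNIV B" unfolding e_def using cB iB by (rule bij_betw_from_nat_into)
  have "onb e"
    unfolding onb_def
  proof (intro conjI allI impI)
    fix i j
    have eB: "e i \<in> B" "e j \<in> B" using bij by (auto simp: bij_betw_def)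
    then show "sq_int (e i)" "ip (e i) (e j) = (if i = j then 1 else 0)"
      using B bij_betw_imp_inj_on[OF bij] by (auto simp: orthonormal_def inj_def)
  next
    fix f assume "sq_int f \<and> (\<forall>i. ip f (e i) = 0)"
    then show "AE x in lebesgue. f x = 0"
      using bij by (intro total) (auto simp: bij_betw_def)
  qed
  then show ?thesis by blast
qed

subsection \<open>Block operators\<close>

lemma l2norm_mono:
  assumes "sq_int f" "sq_int g" "\<And>x. cmod (f x) \<le> cmod (g x)"
  shows "l2norm f \<le> l2norm g"
  unfolding l2norm_def
  by (intro real_sqrt_le_mono integral_mono sq_int_integrable assms power_mono) auto

definition restrict_block :: "(real \<Rightarrow> nat) \<Rightarrow> nat \<Rightarrow> L2fun \<Rightarrow> L2fun" where
  "restrict_block \<kappa> i f = (\<lambda>x. if \<kappa> x = i then f x else 0)"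

text \<open>The direct sum over \<open>i\<close> of the rank-one operators
  \<open>f \<mapsto> \<langle>f, \<xi>\<^sub>i\<rangle> \<xi>\<^sub>i\<close>, where \<open>\<xi>\<^sub>i\<close> is the restriction of \<open>\<xi>\<close> to the block \<open>\<kappa> = i\<close>.\<close>
definition block_op :: "(real \<Rightarrow> nat) \<Rightarrow> L2fun \<Rightarrow> L2op" where
  "block_op \<kappa> \<xi> f = (\<lambda>x. ip f (restrict_block \<kappa> (\<kappa> x) \<xi>) * \<xi> x)"

locale block_operator =
  fixes \<kappa> :: "real \<Rightarrow> nat" and \<xi> :: L2fun
  assumes measurable_block [measurable]: "\<kappa> \<in> measurable lebesgue (count_space UNIV)"
    and sq_int_profile: "sq_int \<xi>"
begin

abbreviation "\<xi>b i \<equiv> restrict_block \<kappa> i \<xi>"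
abbreviation "R \<equiv> block_op \<kappa> \<xi>"

lemma measurable_profile [measurable]: "\<xi> \<in> borel_measurable lebesgue"
  using sq_int_profile by (simp add: sq_int_def)

lemma measurable_blockwise: "(\<lambda>x. c (\<kappa> x)) \<in> borel_measurable lebesgue" for c :: "nat \<Rightarrow> complex"
  by (rule measurable_compose[OF measurable_block]) simp

lemma sq_int_restrict: "sq_int (\<xi>b i)"
proof (rule sq_int_bound[OF sq_int_integrable[OF sq_int_profile]])
  show "\<xi>b i \<in> borel_measurable lebesgue" unfolding restrict_block_def by measurable
qed (auto simp: restrict_block_def)

lemma norm_ip_restrict_le:
  assumes "sq_int f" shows "cmod (ip f (\<xi>b i)) \<le> l2norm f * l2norm \<xi>"
proof -
  have "l2norm (\<xi>b i) \<le> l2norm \<xi>"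
    by (intro l2norm_mono sq_int_restrict sq_int_profile) (auto simp: restrict_block_def)
  then show ?thesis
    using Cauchy_Schwarz_ip[OF assms sq_int_restrict, of i] mult_left_mono[OF _ l2norm_nonneg[of f]]
    by fastforce
qed

text \<open>Covers the images under \<open>R\<close> as well as the limit functions in the
  compactness proof, whose coefficients need not come from any \<open>f\<close>.\<close>

lemma sq_int_blockwise_mult:
  assumes "\<And>i. cmod (c i) \<le> C" shows "sq_int (\<lambda>x. c (\<kappa> x) * \<xi> x)"
  by (rule sq_int_mult_bounded[OF sq_int_profile measurable_blockwise assms])

lemma sq_int_block_op: "sq_int f \<Longrightarrow> sq_int (R f)"
  unfolding block_op_def by (rule sq_int_blockwise_mult[OF norm_ip_restrict_le])

lemma bounded_block_op: "bounded_op R"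
  unfolding bounded_op_def
proof (intro conjI allI impI)
  fix f g a b assume "sq_int f" "sq_int g"
  then have "R (\<lambda>t. a * f t + b * g t) x = a * R f x + b * R g x" for x
    unfolding block_op_def
    by (simp add: ip_add_left ip_scale_left sq_int_scale sq_int_restrict algebra_simps)
  then show "AE x in lebesgue. R (\<lambda>t. a * f t + b * g t) x = a * R f x + b * R g x" by simp
next
  show "\<exists>C. \<forall>f. sq_int f \<longrightarrow> l2norm (R f) \<le> C * l2norm f"
  proof (intro exI[of _ "(l2norm \<xi>)\<^sup>2"] allI impI)
    fix f assume f: "sq_int f"
    have "l2norm (R f) \<le> l2norm (\<lambda>x. complex_of_real (l2norm f * l2norm \<xi>) * \<xi> x)"
    proof (intro l2norm_mono sq_int_block_op f sq_int_scale sq_int_profile)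
      show "cmod (R f x) \<le> cmod (complex_of_real (l2norm f * l2norm \<xi>) * \<xi> x)" for x
        using norm_ip_restrict_le[OF f, of "\<kappa> x"] unfolding block_op_def norm_mult
        by (intro mult_right_mono) (auto simp: norm_mult)
    qed
    then show "l2norm (R f) \<le> (l2norm \<xi>)\<^sup>2 * l2norm f"
      unfolding l2norm_scale by (simp add: norm_mult power2_eq_square algebra_simps)
  qed
qed (rule sq_int_block_op)

text \<open>Partial sums over the blocks are the integrand cut off to \<open>\<kappa> x < n\<close>,
  so dominated convergence applies. Positivity, symmetry and the trace formula are all read off from
  this expansion.\<close>

lemma ip_block_op_sums:
  assumes f: "sq_int f" and g: "sq_int g"
  shows "(\<lambda>i. ip f (\<xi>b i) * cnj (ip g (\<xi>b i))) sums ip (R f) g"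
proof -
  define F where "F x = R f x * cnj (g x)" for x
  define Fi where "Fi i x = (if \<kappa> x = i then F x else 0)" for i x
  have F: "integrable lebesgue F"
    unfolding F_def by (intro ip_integrable sq_int_block_op f g)
  then have [measurable]: "F \<in> borel_measurable lebesgue" by simp
  have [measurable]: "Fi i \<in> borel_measurable lebesgue" for i unfolding Fi_def by measurable
  have Fi: "integrable lebesgue (Fi i)" for i
    by (rule Bochner_Integration.integrable_bound[OF F]) (auto simp: Fi_def)
  have partial: "(\<Sum>i<n. Fi i x) = (if \<kappa> x < n then F x else 0)" for n x
    unfolding Fi_def by simp
  have "(\<lambda>n. LINT x|lebesgue. (\<Sum>i<n. Fi i x)) \<longlonglongrightarrow> (LINT x|lebesgue. F x)"
  proof (rule integral_dominated_convergence[where w = "\<lambda>x. cmod (F x)"])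
    show "AE x in lebesgue. (\<lambda>n. \<Sum>i<n. Fi i x) \<longlonglongrightarrow> F x"
    proof (rule AE_I2)
      fix x
      have "eventually (\<lambda>n. (\<Sum>i<n. Fi i x) = F x) sequentially"
        using eventually_gt_at_top[of "\<kappa> x"] by eventually_elim (simp add: partial)
      then show "(\<lambda>n. \<Sum>i<n. Fi i x) \<longlonglongrightarrow> F x" by (rule tendsto_eventually)
    qed
  qed (use F in \<open>auto simp: partial\<close>)
  moreover have "(LINT x|lebesgue. Fi i x) = ip f (\<xi>b i) * cnj (ip g (\<xi>b i))" for i
  proof -
    have "(LINT x|lebesgue. Fi i x) = (LINT x|lebesgue. ip f (\<xi>b i) * (\<xi>b i x * cnj (g x)))"
      by (rule Bochner_Integration.integral_cong) (auto simp: Fi_def F_def block_op_def restrict_block_def)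
    then show ?thesis by (simp add: ip_cnj) (simp add: ip_def)
  qed
  ultimately show ?thesis
    unfolding sums_def using Fi by (simp add: F_def ip_def[of "R f"])
qed

lemma ip_block_op_self_sums:
  assumes f: "sq_int f"
  shows "(\<lambda>i. (cmod (ip f (\<xi>b i)))\<^sup>2) sums Re (ip (R f) f)" "Im (ip (R f) f) = 0"
proof -
  have *: "(\<lambda>i. complex_of_real ((cmod (ip f (\<xi>b i)))\<^sup>2)) sums ip (R f) f"
    using ip_block_op_sums[OF f f] by (simp only: complex_norm_square)
  show "(\<lambda>i. (cmod (ip f (\<xi>b i)))\<^sup>2) sums Re (ip (R f) f)"
    using sums_Re[OF *] by (simp del: of_real_power)
  have "(\<lambda>i. 0) sums Im (ip (R f) f)"
    using sums_Im[OF *] by (simp del: of_real_power)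
  then show "Im (ip (R f) f) = 0"
    by (rule sums_unique2[OF _ sums_zero])
qed

lemma positive_block_op: "positive_op R"
  unfolding positive_op_def
  using bounded_block_op ip_block_op_self_sums
  by (auto intro: sums_le[OF _ sums_zero ip_block_op_self_sums(1)])

lemma hermitian_block_op:
  assumes f: "sq_int f" and g: "sq_int g" shows "ip (R f) g = ip f (R g)"
proof -
  have "(\<lambda>i. cnj (ip g (\<xi>b i) * cnj (ip f (\<xi>b i)))) sums cnj (ip (R g) f)"
    using ip_block_op_sums[OF g f] by (simp only: sums_cnj)
  then have "(\<lambda>i. ip f (\<xi>b i) * cnj (ip g (\<xi>b i))) sums ip f (R g)"
    by (simp add: ip_cnj mult.commute)
  with ip_block_op_sums[OF f g] show ?thesis by (rule sums_unique2)
qed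

text \<open>The coefficient sequences of a bounded sequence lie in a product of discs, which is
  sequentially compact, so a subsequence converges coordinatewise. Because the profile is
  square-integrable, dominated convergence turns this into norm convergence of the images.\<close>

lemma compact_block_op: "compact_op R"
  unfolding compact_op_def
proof (intro conjI bounded_block_op allI impI)
  fix fs :: "nat \<Rightarrow> L2fun" and B :: real
  assume "(\<forall>k. sq_int (fs k)) \<and> (\<forall>k. l2norm (fs k) \<le> B)"
  then have fs: "\<And>k. sq_int (fs k)" and B: "\<And>k. l2norm (fs k) \<le> B" by auto
  define M where "M = B * l2norm \<xi>"
  define c where "c k i = ip (fs k) (\<xi>b i)" for k i
  have c: "cmod (c k i) \<le> M" for k i
    unfolding c_def M_def using norm_ip_restrict_le[OF fs, of k i] mult_right_mono[OF B[of k] l2norm_nonneg[of \<xi>]]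
    by linarith
  have "compact (PiE UNIV (\<lambda>_::nat. cball (0::complex) M))"
    using compactin_PiE[of "\<lambda>_. euclidean" UNIV "\<lambda>_::nat. cball (0::complex) M"]
    by (simp add: euclidean_product_topology)
  then have "seq_compact (PiE UNIV (\<lambda>_::nat. cball (0::complex) M))"
    by (simp add: compact_eq_seq_compact_metric)
  then obtain \<alpha> r where \<alpha>: "\<alpha> \<in> PiE UNIV (\<lambda>_::nat. cball (0::complex) M)"
    and r: "strict_mono r" and lim: "(c \<circ> r) \<longlonglongrightarrow> \<alpha>"
    by (rule seq_compactE[where f = c]) (use c in auto)
  have limi: "(\<lambda>k. c (r k) i) \<longlonglongrightarrow> \<alpha> i" for i
    using continuous_on_tendsto_compose[OF continuous_on_product_coordinates lim, of i] by simp
  have \<alpha>M: "cmod (\<alpha> i) \<le> M" for i using \<alpha> by (auto simp: PiE_def)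
  define g where "g x = \<alpha> (\<kappa> x) * \<xi> x" for x
  have g: "sq_int g" unfolding g_def by (rule sq_int_blockwise_mult[OF \<alpha>M])
  have [measurable]: "(\<lambda>x. R (fs (r k)) x - g x) \<in> borel_measurable lebesgue" for k
    using sq_int_diff[OF sq_int_block_op[OF fs] g] by (simp add: sq_int_def)
  have "(\<lambda>k. LINT x|lebesgue. (cmod (R (fs (r k)) x - g x))\<^sup>2) \<longlonglongrightarrow> (LINT x::real|lebesgue. 0)"
  proof (rule integral_dominated_convergence[where w = "\<lambda>x. (2 * M)\<^sup>2 * (cmod (\<xi> x))\<^sup>2"])
    have diff: "R (fs (r k)) x - g x = (c (r k) (\<kappa> x) - \<alpha> (\<kappa> x)) * \<xi> x" for k x
      by (simp add: block_op_def g_def c_def algebra_simps)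
    show "AE x in lebesgue. (\<lambda>k. (cmod (R (fs (r k)) x - g x))\<^sup>2) \<longlonglongrightarrow> 0"
    proof (rule AE_I2)
      fix x
      have "(\<lambda>k. (cmod ((c (r k) (\<kappa> x) - \<alpha> (\<kappa> x)) * \<xi> x))\<^sup>2) \<longlonglongrightarrow> (cmod ((\<alpha> (\<kappa> x) - \<alpha> (\<kappa> x)) * \<xi> x))\<^sup>2"
        by (intro tendsto_intros limi)
      then show "(\<lambda>k. (cmod (R (fs (r k)) x - g x))\<^sup>2) \<longlonglongrightarrow> 0"
        unfolding diff by simp
    qed
    show "AE x in lebesgue. norm ((cmod (R (fs (r k)) x - g x))\<^sup>2) \<le> (2 * M)\<^sup>2 * (cmod (\<xi> x))\<^sup>2" for k
    proof (rule AE_I2)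
      fix x
      have "cmod (c (r k) (\<kappa> x) - \<alpha> (\<kappa> x)) \<le> 2 * M"
        using norm_triangle_ineq4[of "c (r k) (\<kappa> x)" "\<alpha> (\<kappa> x)"] c[of "r k" "\<kappa> x"] \<alpha>M[of "\<kappa> x"] by linarith
      then have "(cmod (c (r k) (\<kappa> x) - \<alpha> (\<kappa> x)) * cmod (\<xi> x))\<^sup>2 \<le> (2 * M * cmod (\<xi> x))\<^sup>2"
        by (intro power_mono mult_right_mono) auto
      then show "norm ((cmod (R (fs (r k)) x - g x))\<^sup>2) \<le> (2 * M)\<^sup>2 * (cmod (\<xi> x))\<^sup>2"
        unfolding diff by (simp add: norm_mult power_mult_distrib)
    qed
  qed (use sq_int_integrable[OF sq_int_profile] in auto)
  from tendsto_real_sqrt[OF this] have "(\<lambda>k. l2norm (\<lambda>t. R (fs (r k)) t - g t)) \<longlonglongrightarrow> 0"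
    by (simp add: l2norm_def)
  with r g show "\<exists>r g. strict_mono r \<and> sq_int g \<and> (\<lambda>k. l2norm (\<lambda>t. R (fs (r k)) t - g t)) \<longlonglongrightarrow> 0"
    by blast
qed

end

subsection \<open>Positive operators and traces\<close>

lemma positive_op_sq_int: "positive_op A \<Longrightarrow> sq_int f \<Longrightarrow> sq_int (A f)"
  by (simp add: positive_op_def bounded_op_def)

lemma positive_op_linear:
  "\<lbrakk>positive_op A; sq_int f; sq_int g\<rbrakk> \<Longrightarrow>
    AE x in lebesgue. A (\<lambda>t. a * f t + b * g t) x = a * A f x + b * A g x"
  by (simp add: positive_op_def bounded_op_def)

text \<open>\<open>y = A u - \<mu> u\<close> satisfies \<open>A y = - \<mu> y\<close>, which contradicts positivity unless \<open>y = 0\<close>.\<close>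
lemma positive_op_sqrt_eigenvector:
  fixes \<mu> :: real
  assumes A: "positive_op A" and u: "sq_int u" and \<mu>: "0 < \<mu>"
    and sq: "AE x in lebesgue. A (A u) x = of_real (\<mu>\<^sup>2) * u x"
  shows "AE x in lebesgue. A u x = of_real \<mu> * u x"
proof -
  note sA = positive_op_sq_int[OF A]
  define y where "y = (\<lambda>t. 1 * A u t + (- of_real \<mu>) * u t)"
  have y: "sq_int y" unfolding y_def by (intro sq_int_add sq_int_scale sA u)
  have "AE x in lebesgue. A y x = 1 * A (A u) x + (- of_real \<mu>) * A u x"
    unfolding y_def by (intro positive_op_linear A sA u)
  then have "AE x in lebesgue. A y x = - of_real \<mu> * y x"
    using sq by eventually_elim (simp add: y_def algebra_simps power2_eq_square)
  then have "ip (A y) y = ip (\<lambda>x. - of_real \<mu> * y x) y"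
    by (intro ip_cong_AE sA y sq_int_scale)
  also have "\<dots> = - of_real (\<mu> * (l2norm y)\<^sup>2)"
    unfolding ip_scale_left ip_self by simp
  finally have "Re (ip (A y) y) = - (\<mu> * (l2norm y)\<^sup>2)" by simp
  moreover have "0 \<le> Re (ip (A y) y)" using A y by (simp add: positive_op_def)
  ultimately have "l2norm y = 0"
    using \<mu> by (smt (verit) mult_pos_pos zero_less_power2)
  then have "AE x in lebesgue. y x = 0" using l2norm_eq_0_iff[OF y] by simp
  then show ?thesis by eventually_elim (simp add: y_def algebra_simps)
qed

text \<open>Splitting \<open>g\<close> into \<open>h\<close>, orthogonal to \<open>u\<close>, and a
  multiple of \<open>u\<close>, the form decouples into the part at \<open>h\<close>, which is
  nonnegative, and \<open>\<mu>\<close> times the squared coefficient.\<close>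

lemma positive_op_ge_eigenprojection:
  fixes \<mu> :: real
  assumes A: "positive_op A" and u: "sq_int u" and uu: "ip u u = 1"
    and eig: "AE x in lebesgue. A u x = of_real \<mu> * u x" and g: "sq_int g"
  shows "\<mu> * (cmod (ip g u))\<^sup>2 \<le> Re (ip (A g) g)"
proof -
  note sA = positive_op_sq_int[OF A]
  define c where "c = ip g u"
  define h where "h = (\<lambda>x. g x - c * u x)"
  have h: "sq_int h" unfolding h_def by (intro sq_int_diff sq_int_scale g u)
  have hu: "ip h u = 0"
    unfolding h_def by (simp add: ip_diff_left ip_scale_left g u sq_int_scale uu c_def)
  have uh: "ip u h = 0" using hu ip_cnj[of h u] by simp
  define d where "d = ip (A h) u"
  define k where "k z = (\<lambda>t. 1 * h t + z * u t)" for z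
  have k: "sq_int (k z)" for z unfolding k_def by (intro sq_int_add sq_int_scale h u)
  have form: "ip (A (k z)) (k z) = ip (A h) h + cnj z * d + of_real (\<mu> * (cmod z)\<^sup>2)" for z
  proof -
    have "AE x in lebesgue. A (k z) x = 1 * A h x + z * A u x"
      unfolding k_def by (intro positive_op_linear A h u)
    then have "AE x in lebesgue. A (k z) x = A h x + (z * of_real \<mu>) * u x"
      using eig by eventually_elim simp
    then have "ip (A (k z)) (k z) = ip (\<lambda>x. A h x + (z * of_real \<mu>) * u x) (k z)"
      by (intro ip_cong_AE sA k sq_int_add sq_int_scale h u)
    also have "\<dots> = ip (A h) (k z) + (z * of_real \<mu>) * ip u (k z)"
      by (subst ip_add_left) (auto simp: ip_scale_left intro!: sA k sq_int_scale h u)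
    also have "ip (A h) (k z) = ip (A h) h + cnj z * d"
      unfolding k_def d_def
      by (subst ip_add_right) (auto simp: ip_scale_right intro!: sA sq_int_scale h u)
    also have "ip u (k z) = cnj z"
      unfolding k_def
      by (subst ip_add_right) (auto simp: ip_scale_right uh uu intro!: sq_int_scale h u)
    finally show ?thesis by (simp add: complex_norm_square mult_ac del: of_real_power)
  qed
  have pos: "Im (ip (A f) f) = 0" "0 \<le> Re (ip (A f) f)" if "sq_int f" for f
    using A that by (auto simp: positive_op_def)
  \<comment> \<open>The cross term vanishes because the form is real: testing with
    \<open>z = 1\<close> kills the imaginary part of \<open>d\<close>, and \<open>z = \<i>\<close>
    its real part.\<close>
  have "Im d = 0"
    using pos(1)[OF k[of 1]] pos(1)[OF h] unfolding form by simp
  moreover have "Re d = 0"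
    using pos(1)[OF k[of \<i>]] pos(1)[OF h] unfolding form by simp
  ultimately have "d = 0" by (simp add: complex_eq_iff)
  have "k c = g" by (simp add: k_def h_def)
  then have "ip (A g) g = ip (A h) h + of_real (\<mu> * (cmod c)\<^sup>2)"
    using form[of c] \<open>d = 0\<close> by simp
  then have "Re (ip (A g) g) = Re (ip (A h) h) + \<mu> * (cmod c)\<^sup>2" by simp
  then show ?thesis using pos(2)[OF h] by (simp add: c_def)
qed

section \<open>Traces compressed by the square root of the weight\<close>

lemma sq_int_sqrtDE:
  assumes "sq_int f" shows "sq_int (sqrtDE n f)"
proof -
  have [measurable]: "Kset n \<in> sets lebesgue" unfolding Kset_def by auto
  have [measurable]: "(\<lambda>x. exp (x / 2)) \<in> borel_measurable (lebesgue :: real measure)"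
    by (rule measurable_completion) simp
  show ?thesis unfolding sqrtDE_def
  proof (rule sq_int_mult_bounded[OF assms])
    show "(\<lambda>x. complex_of_real (indicator (Kset n) x * exp (x / 2))) \<in> borel_measurable lebesgue"
      by measurable
    \<comment> \<open>The summand 1 covers \<open>n = 0\<close>, where the left piece reaches up to
      1 and so beyond \<open>n\<close>.\<close>
    show "cmod (complex_of_real (indicator (Kset n) x * exp (x / 2))) \<le> exp (real n / 2 + 1)" for x
      by (auto simp: indicator_def Kset_def norm_mult)
  qed
qed

lemma ip_sqrtDE: "ip (sqrtDE n f) g = ip f (sqrtDE n g)"
  unfolding ip_def sqrtDE_def by (rule Bochner_Integration.integral_cong) auto

text \<open>As a basis exists, the one chosen in \<open>trace_pos\<close> is genuine; nothing else
  about the choice enters the later arguments.\<close>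

lemma trace_pos_onb: "\<exists>e. onb e \<and> (\<forall>P. trace_pos P = (\<Sum>i. ennreal (Re (ip (P (e i)) (e i)))))"
  using someI_ex[OF exists_onb] unfolding trace_pos_def Let_def by blast

lemma parseval_sqrtDE:
  assumes e: "onb e" and h: "sq_int h"
  shows "(\<Sum>i. ennreal ((cmod (ip (sqrtDE n (e i)) h))\<^sup>2)) = ennreal ((l2norm (sqrtDE n h))\<^sup>2)"
proof -
  have "cmod (ip (sqrtDE n (e i)) h) = cmod (ip (sqrtDE n h) (e i))" for i
    unfolding ip_sqrtDE[of n "e i"] using ip_cnj[of "e i" "sqrtDE n h"] by (metis complex_mod_cnj)
  then show ?thesis
    using parseval[OF e sq_int_sqrtDE[OF h], of n]
    by (intro suminf_ennreal_eq) auto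
qed

text \<open>The hypothesis says that \<open>A\<close> dominates \<open>\<mu>\<close> times the
  rank-one form given by \<open>u\<close>, whose compressed trace is evaluated by Parseval's
  identity.\<close>

lemma trace_sqrtDE_ge:
  assumes A: "positive_op A" and u: "sq_int u" and \<mu>: "0 \<le> \<mu>"
    and ge: "\<And>g. sq_int g \<Longrightarrow> \<mu> * (cmod (ip g u))\<^sup>2 \<le> Re (ip (A g) g)"
  shows "ennreal (\<mu> * (l2norm (sqrtDE n u))\<^sup>2) \<le> trace_pos (sqrtDE n \<circ> A \<circ> sqrtDE n)"
proof -
  obtain e where e: "onb e" and tr: "\<And>P. trace_pos P = (\<Sum>i. ennreal (Re (ip (P (e i)) (e i))))"
    using trace_pos_onb by blast
  have se: "sq_int (e i)" for i using e by (simp add: onb_def)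
  have "ennreal (\<mu> * (l2norm (sqrtDE n u))\<^sup>2) = ennreal \<mu> * (\<Sum>i. ennreal ((cmod (ip (sqrtDE n (e i)) u))\<^sup>2))"
    using \<mu> by (simp add: parseval_sqrtDE[OF e u] ennreal_mult)
  also have "\<dots> = (\<Sum>i. ennreal (\<mu> * (cmod (ip (sqrtDE n (e i)) u))\<^sup>2))"
    using \<mu> by (simp add: ennreal_mult)
  also have "\<dots> \<le> (\<Sum>i. ennreal (Re (ip (A (sqrtDE n (e i))) (sqrtDE n (e i)))))"
    by (intro suminf_le ennreal_leI ge sq_int_sqrtDE se) auto
  also have "\<dots> = trace_pos (sqrtDE n \<circ> A \<circ> sqrtDE n)"
    unfolding tr by (simp add: ip_sqrtDE)
  finally show ?thesis .
qed

text \<open>Only block \<open>m\<close> is visible under \<open>sqrtDE n\<close>, and there the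
  operator has rank one, so the trace is a squared norm by Parseval's identity.\<close>

lemma (in block_operator) trace_sqrtDE_block_op:
  assumes K: "AE x in lebesgue. x \<in> Kset n \<longrightarrow> \<kappa> x = m"
  shows "trace_pos (sqrtDE n \<circ> R \<circ> sqrtDE n) = ennreal ((l2norm (sqrtDE n (\<xi>b m)))\<^sup>2)"
proof -
  obtain e where e: "onb e" and tr: "\<And>P. trace_pos P = (\<Sum>i. ennreal (Re (ip (P (e i)) (e i))))"
    using trace_pos_onb by blast
  have se: "sq_int (e i)" for i using e by (simp add: onb_def)
  have zero: "ip (sqrtDE n f) (\<xi>b j) = 0" if "sq_int f" "j \<noteq> m" for f j
  proof -
    have "AE x in lebesgue. sqrtDE n (\<xi>b j) x = 0"
      using K by eventually_elim (use that(2) in \<open>auto simp: sqrtDE_def restrict_block_def indicator_def\<close>)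
    then have "ip (sqrtDE n (\<xi>b j)) f = ip (\<lambda>x. 0) f"
      by (intro ip_cong_AE sq_int_sqrtDE sq_int_restrict sq_int_zero that)
    then have "ip f (sqrtDE n (\<xi>b j)) = 0"
      using ip_cnj[of "sqrtDE n (\<xi>b j)" f] by simp
    then show ?thesis by (simp add: ip_sqrtDE)
  qed
  have "Re (ip (R (sqrtDE n f)) (sqrtDE n f)) = (cmod (ip (sqrtDE n f) (\<xi>b m)))\<^sup>2" if f: "sq_int f" for f
  proof (rule sums_unique2[OF ip_block_op_self_sums(1)[OF sq_int_sqrtDE[OF f]]])
    have "(\<lambda>i. (cmod (ip (sqrtDE n f) (\<xi>b i)))\<^sup>2) sums (\<Sum>i\<in>{m}. (cmod (ip (sqrtDE n f) (\<xi>b i)))\<^sup>2)"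
      by (rule sums_finite) (auto simp: zero f)
    then show "(\<lambda>i. (cmod (ip (sqrtDE n f) (\<xi>b i)))\<^sup>2) sums (cmod (ip (sqrtDE n f) (\<xi>b m)))\<^sup>2"
      by simp
  qed
  then show ?thesis
    unfolding tr using parseval_sqrtDE[OF e sq_int_restrict] by (simp add: ip_sqrtDE se)
qed

subsection \<open>The counterexample\<close>

text \<open>The interval from \<open>k\<close> to \<open>k + 1\<close> is one half of
  \<open>Kset (block_index k + 1)\<close>; its mirror image is the one starting at
  \<open>- 1 - k\<close>.\<close>

definition block_index :: "int \<Rightarrow> nat" where
  "block_index k = (if 0 \<le> k then nat k else nat (- k - 1))"

lemma block_index_eq_iff: "block_index k = n \<longleftrightarrow> k = int n \<or> k = - 1 - int n"
  unfolding block_index_def by auto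

lemma block_index_reflect [simp]: "block_index (- 1 - k) = block_index k"
  unfolding block_index_def by auto

lemma measurable_floor_lebesgue:
  "(\<lambda>x::real. G \<lfloor>x\<rfloor>) \<in> measurable lebesgue (count_space UNIV)"
  by (rule measurable_completion) simp

lemma borel_measurable_floor_lebesgue:
  "(\<lambda>x::real. G \<lfloor>x\<rfloor> :: 'a::topological_space) \<in> borel_measurable lebesgue"
  by (rule measurable_compose[OF measurable_floor_lebesgue[of "\<lambda>k. k"]]) simp

definition unit_ind :: "int \<Rightarrow> L2fun" where
  "unit_ind k = indicator {of_int k..<of_int k + 1}"

lemma unit_ind_apply: "unit_ind k x = (if \<lfloor>x\<rfloor> = k then 1 else 0)"
  unfolding unit_ind_def by (auto simp: indicator_def floor_eq_iff)

lemma sq_int_unit_ind: "sq_int (unit_ind k)"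
  unfolding unit_ind_def by (intro sq_int_indicator lmeasurable_Ico)

lemma ip_unit_ind: "ip (unit_ind k) (unit_ind l) = (if k = l then 1 else 0)"
proof -
  have "{real_of_int k..<of_int k + 1} \<inter> {of_int l..<of_int l + 1} = {}" if "k \<noteq> l"
    using that by (auto simp flip: floor_eq_iff)
  then show ?thesis unfolding unit_ind_def by (subst ip_indicator_indicator) auto
qed

text \<open>Each value of the index is taken on two unit intervals, so the integral is at most twice
  the sum of \<open>c\<close>.\<close>

lemma block_index_floor_integrable:
  fixes c :: "nat \<Rightarrow> real"
  assumes c: "\<And>n. 0 \<le> c n" "summable c"
  shows "integrable lebesgue (\<lambda>x::real. c (block_index \<lfloor>x\<rfloor>))"
proof (rule integrableI_nonneg)
  define J where "J n = {real n..<real n + 1} \<union> {- 1 - real n..<- real n}" for n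
  have J: "J n \<in> sets lebesgue" for n unfolding J_def by auto
  have mem: "x \<in> J n \<longleftrightarrow> block_index \<lfloor>x\<rfloor> = n" for x n
    unfolding J_def block_index_eq_iff floor_eq_iff by auto
  have ind: "(\<Sum>n. ennreal (c n) * indicator (J n) x) = ennreal (c (block_index \<lfloor>x\<rfloor>))" for x
    by (subst suminf_finite[of "{block_index \<lfloor>x\<rfloor>}"]) (auto simp: mem indicator_def)
  have "emeasure lebesgue (J n) \<le> 2" for n
  proof -
    have "emeasure lebesgue (J n) \<le> emeasure lebesgue {real n..<real n + 1} + emeasure lebesgue {- 1 - real n..<- real n}"
      unfolding J_def by (intro emeasure_subadditive) auto
    also have "\<dots> = 2" by simp
    finally show ?thesis .
  qed
  then have "(\<Sum>n. ennreal (c n) * emeasure lebesgue (J n)) \<le> (\<Sum>n. ennreal (c n) * 2)"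
    by (intro suminf_le mult_left_mono) auto
  also have "\<dots> = ennreal (\<Sum>n. c n) * 2"
    using c by (simp add: suminf_ennreal2)
  also have "\<dots> < \<infinity>" by (simp add: ennreal_mult_less_top)
  also have "(\<Sum>n. ennreal (c n) * emeasure lebesgue (J n)) = (\<integral>\<^sup>+x. (\<Sum>n. ennreal (c n) * indicator (J n) x) \<partial>lebesgue)"
    by (subst nn_integral_suminf) (use J in \<open>auto simp: nn_integral_cmult_indicator\<close>)
  finally show "(\<integral>\<^sup>+x. ennreal (c (block_index \<lfloor>x\<rfloor>)) \<partial>(lebesgue :: real measure)) < \<infinity>"
    by (simp only: ind)
qed (use c borel_measurable_floor_lebesgue in auto)

lemma summable_exp_neg:
  assumes "0 < a" shows "summable (\<lambda>n. exp (- a * real n))"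
proof -
  have "exp (- a * real n) = exp (- a) ^ n" for n
    by (subst exp_of_nat2_mult[symmetric]) simp
  then show ?thesis using assms by (simp add: summable_geometric)
qed

section \<open>The profiles of \<open>S\<close> (sign \<open>s = 1\<close>) and of \<open>T\<close>
  (sign \<open>s = -1\<close>)\<close>

definition profile :: "real \<Rightarrow> L2fun" where
  "profile s x = (let n = real (block_index \<lfloor>x\<rfloor>) in
     complex_of_real (if x < 0 then exp (- n / 4) else s * exp (- 3 * n / 4)))"

lemma cmod_profile_square:
  assumes "s\<^sup>2 = 1"
  shows "(cmod (profile s x))\<^sup>2 =
    (let n = real (block_index \<lfloor>x\<rfloor>) in if x < 0 then exp (- n / 2) else exp (- 3 * n / 2))"
  using assms by (simp add: profile_def Let_def power_mult_distrib flip: exp_double)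

lemma block_operator_profile:
  assumes "s\<^sup>2 = 1"
  shows "block_operator (\<lambda>x. block_index \<lfloor>x\<rfloor>) (profile s)"
proof
  show "sq_int (profile s)"
  proof (rule sq_int_bound)
    show "integrable lebesgue (\<lambda>x::real. exp (- (1/2) * real (block_index \<lfloor>x\<rfloor>)))"
      by (intro block_index_floor_integrable summable_exp_neg) auto
    define P where "P k = (let n = real (block_index k) in
        complex_of_real (if k < 0 then exp (- n / 4) else s * exp (- 3 * n / 4)))" for k
    have "profile s = (\<lambda>x. P \<lfloor>x\<rfloor>)"
      by (auto simp: profile_def P_def)
    then show "profile s \<in> borel_measurable lebesgue"
      by (simp only: borel_measurable_floor_lebesgue)
    show "(cmod (profile s x))\<^sup>2 \<le> exp (- (1/2) * real (block_index \<lfloor>x\<rfloor>))" for x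
      unfolding cmod_profile_square[OF assms] by (simp add: Let_def)
  qed
qed (rule measurable_floor_lebesgue)

text \<open>The two pieces of \<open>Kset\<close> are closed but the floor cells are half-open, so
  failure is possible only at the right endpoints.\<close>

lemma Kset_block_index: "AE x in lebesgue. x \<in> Kset (Suc n) \<longrightarrow> block_index \<lfloor>x\<rfloor> = n"
proof (rule AE_I'[of "{- real n, real n + 1}"])
  show "{x \<in> space lebesgue. \<not> (x \<in> Kset (Suc n) \<longrightarrow> block_index \<lfloor>x\<rfloor> = n)} \<subseteq> {- real n, real n + 1}"
    unfolding Kset_def block_index_eq_iff floor_eq_iff by auto
qed (simp add: negligible_iff_null_sets[symmetric])

lemma psi_profile_finite:
  assumes s: "s\<^sup>2 = 1"
  shows "psi (block_op (\<lambda>x. block_index \<lfloor>x\<rfloor>) (profile s)) < \<infinity>"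
proof -
  interpret block_operator "\<lambda>x. block_index \<lfloor>x\<rfloor>" "profile s"
    by (rule block_operator_profile[OF s])
  have bound: "(l2norm (sqrtDE (Suc n) (\<xi>b n)))\<^sup>2 \<le> 2 * exp 1 * exp (- (1/2) * real n)" for n
  proof -
    \<comment> \<open>On the negative half \<open>exp x\<close> is below 1 and the squared profile
      is \<open>exp (- n / 2)\<close>; on the positive half \<open>exp x\<close> is below
      \<open>exp (n + 1)\<close> and the squared profile is \<open>exp (- 3 * n / 2)\<close>. Both
      products are at most \<open>C\<close>.\<close>
    define C where "C = exp (1 - real n / 2)"
    have "(l2norm (sqrtDE (Suc n) (\<xi>b n)))\<^sup>2
        \<le> (LINT x|lebesgue. C * (cmod (unit_ind n x))\<^sup>2 + C * (cmod (unit_ind (- 1 - int n) x))\<^sup>2)"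
      unfolding l2norm_power2
    proof (intro integral_mono sq_int_integrable sq_int_sqrtDE sq_int_restrict)
      fix x :: real
      show "(cmod (sqrtDE (Suc n) (\<xi>b n) x))\<^sup>2 \<le> C * (cmod (unit_ind n x))\<^sup>2 + C * (cmod (unit_ind (- 1 - int n) x))\<^sup>2"
      proof (cases "block_index \<lfloor>x\<rfloor> = n")
        case False
        then show ?thesis by (simp add: sqrtDE_def restrict_block_def C_def)
      next
        case True
        then have eq: "(cmod (unit_ind n x))\<^sup>2 + (cmod (unit_ind (- 1 - int n) x))\<^sup>2 = 1"
          by (auto simp: unit_ind_apply block_index_eq_iff)
        have "(cmod (sqrtDE (Suc n) (\<xi>b n) x))\<^sup>2
            = (indicator (Kset (Suc n)) x)\<^sup>2 * exp x * (cmod (profile s x))\<^sup>2"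
          using True by (simp add: sqrtDE_def restrict_block_def norm_mult power_mult_distrib flip: exp_double)
        also have "\<dots> \<le> 1 * exp x * (cmod (profile s x))\<^sup>2"
          by (intro mult_right_mono) (auto simp: indicator_def)
        also have "\<dots> \<le> C"
        proof (cases "x < 0")
          case True
          with \<open>block_index \<lfloor>x\<rfloor> = n\<close> show ?thesis
            by (simp add: cmod_profile_square[OF s] C_def exp_add[symmetric])
        next
          case False
          with True have "x < real n + 1"
            unfolding block_index_eq_iff floor_eq_iff by auto
          with True False show ?thesis
            by (simp add: cmod_profile_square[OF s] C_def exp_add[symmetric])
        qed
        also have "\<dots> = C * (cmod (unit_ind n x))\<^sup>2 + C * (cmod (unit_ind (- 1 - int n) x))\<^sup>2"
          using eq by (metis distrib_left mult.right_neutral)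
        finally show ?thesis .
      qed
    qed (auto intro!: sq_int_integrable sq_int_unit_ind)
    also have "\<dots> = C * (l2norm (unit_ind n))\<^sup>2 + C * (l2norm (unit_ind (- 1 - int n)))\<^sup>2"
      unfolding l2norm_power2
      by (subst Bochner_Integration.integral_add) (auto intro!: sq_int_integrable sq_int_unit_ind)
    also have "\<dots> = 2 * C"
    proof -
      have "(l2norm (unit_ind k))\<^sup>2 = 1" for k
        using ip_unit_ind[of k k] unfolding ip_self by (metis of_real_eq_1_iff)
      then show ?thesis by simp
    qed
    also have "\<dots> = 2 * exp 1 * exp (- (1/2) * real n)"
      by (simp add: C_def exp_add[symmetric])
    finally show ?thesis .
  qed
  have "psi R = (\<Sum>n. ennreal ((l2norm (sqrtDE (Suc n) (\<xi>b n)))\<^sup>2))"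
    unfolding psi_def by (simp add: trace_sqrtDE_block_op[OF Kset_block_index])
  also have "\<dots> \<le> (\<Sum>n. ennreal (2 * exp 1 * exp (- (1/2) * real n)))"
    by (intro suminf_le ennreal_leI bound) auto
  also have "\<dots> = ennreal (\<Sum>n. 2 * exp 1 * exp (- (1/2) * real n))"
    by (intro suminf_ennreal2 summable_mult summable_exp_neg) auto
  also have "\<dots> < \<infinity>" by simp
  finally show ?thesis .
qed

section \<open>A concrete absolute value of the difference\<close>

definition abs_weight :: "int \<Rightarrow> real" where
  "abs_weight k = 2 * exp (- real (block_index k))"

text \<open>The square root appears because a rank-one block carries its profile twice; the scalar
  that results is \<open>abs_weight\<close>, the product \<open>2 a b\<close> of the two
  amplitudes.\<close>

definition abs_profile :: L2fun where
  "abs_profile x = complex_of_real (sqrt (abs_weight \<lfloor>x\<rfloor>))"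

lemma abs_weight_pos: "0 < abs_weight k"
  by (simp add: abs_weight_def)

text \<open>Coding the floor by \<open>int_encode\<close> makes every unit interval a block of its
  own, so the absolute value is again a block operator and inherits positivity and symmetry.\<close>

lemma block_operator_abs_profile: "block_operator (\<lambda>x. int_encode \<lfloor>x\<rfloor>) abs_profile"
proof
  show "sq_int abs_profile"
  proof (rule sq_int_bound)
    show "integrable lebesgue (\<lambda>x::real. 2 * exp (- 1 * real (block_index \<lfloor>x\<rfloor>)))"
      by (intro integrable_mult_right block_index_floor_integrable summable_exp_neg) auto
    show "abs_profile \<in> borel_measurable lebesgue"
      unfolding abs_profile_def[abs_def]
      by (rule borel_measurable_floor_lebesgue[of "\<lambda>k. complex_of_real (sqrt (abs_weight k))"])
    show "(cmod (abs_profile x))\<^sup>2 \<le> 2 * exp (- 1 * real (block_index \<lfloor>x\<rfloor>))" for x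
      using abs_weight_pos[of "\<lfloor>x\<rfloor>"] by (simp add: abs_profile_def) (simp add: abs_weight_def)
  qed
qed (rule measurable_floor_lebesgue)

abbreviation "abs_op \<equiv> block_op (\<lambda>x. int_encode \<lfloor>x\<rfloor>) abs_profile"

lemma abs_op_apply: "abs_op f x = of_real (abs_weight \<lfloor>x\<rfloor>) * ip f (unit_ind \<lfloor>x\<rfloor>)"
proof -
  define r where "r = sqrt (abs_weight \<lfloor>x\<rfloor>)"
  have "restrict_block (\<lambda>x. int_encode \<lfloor>x\<rfloor>) (int_encode \<lfloor>x\<rfloor>) abs_profile
      = (\<lambda>y. of_real r * unit_ind \<lfloor>x\<rfloor> y)"
    by (rule ext) (auto simp: r_def restrict_block_def abs_profile_def unit_ind_apply dest: injD[OF inj_int_encode])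
  then have "abs_op f x = of_real (r * r) * ip f (unit_ind \<lfloor>x\<rfloor>)"
    unfolding block_op_def by (simp only: ip_scale_right) (simp add: abs_profile_def r_def[symmetric])
  also have "r * r = abs_weight \<lfloor>x\<rfloor>"
    using abs_weight_pos[of "\<lfloor>x\<rfloor>"] by (simp add: r_def)
  finally show ?thesis .
qed

lemma restrict_profile:
  "restrict_block (\<lambda>x. block_index \<lfloor>x\<rfloor>) n (profile s) =
     (\<lambda>y. of_real (exp (- real n / 4)) * unit_ind (- 1 - int n) y
        + of_real (s * exp (- 3 * real n / 4)) * unit_ind n y)"
proof
  fix y
  show "restrict_block (\<lambda>x. block_index \<lfloor>x\<rfloor>) n (profile s) y =
     of_real (exp (- real n / 4)) * unit_ind (- 1 - int n) y
        + of_real (s * exp (- 3 * real n / 4)) * unit_ind n y"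
  proof (cases "block_index \<lfloor>y\<rfloor> = n")
    case False
    then show ?thesis by (auto simp: restrict_block_def unit_ind_apply block_index_eq_iff)
  next
    case True
    then consider "\<lfloor>y\<rfloor> = int n" | "\<lfloor>y\<rfloor> = - 1 - int n" by (auto simp: block_index_eq_iff)
    then show ?thesis
    proof cases
      case 1
      then have "\<not> y < 0" by linarith
      with 1 True show ?thesis by (simp add: restrict_block_def profile_def Let_def unit_ind_apply)
    next
      case 2
      then have "y < 0" by linarith
      with 2 True show ?thesis by (simp add: restrict_block_def profile_def Let_def unit_ind_apply)
    qed
  qed
qed

text \<open>The difference of the two block operators is \<open>abs_op\<close> followed by the reflection \<open>x \<mapsto> - x\<close>.\<close>
lemma block_op_profile_diff:
  assumes f: "sq_int f"
  shows "(block_op (\<lambda>x. block_index \<lfloor>x\<rfloor>) (profile 1) f - block_op (\<lambda>x. block_index \<lfloor>x\<rfloor>) (profile (-1)) f) x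
    = of_real (abs_weight \<lfloor>x\<rfloor>) * ip f (unit_ind (- 1 - \<lfloor>x\<rfloor>))"
proof -
  define n where "n = block_index \<lfloor>x\<rfloor>"
  define a b where "a = exp (- real n / 4)" and "b = exp (- 3 * real n / 4)"
  have ab: "abs_weight \<lfloor>x\<rfloor> = 2 * a * b"
    by (simp add: abs_weight_def n_def[symmetric] a_def b_def exp_add[symmetric])
  have "ip f (restrict_block (\<lambda>x. block_index \<lfloor>x\<rfloor>) n (profile s))
      = of_real a * ip f (unit_ind (- 1 - int n)) + of_real (s * b) * ip f (unit_ind n)" for s
    unfolding restrict_profile a_def[symmetric] b_def[symmetric]
    by (subst ip_add_right) (auto simp only: ip_scale_right complex_cnj_complex_of_real intro!: f sq_int_scale sq_int_unit_ind)
  then have "(block_op (\<lambda>x. block_index \<lfloor>x\<rfloor>) (profile 1) f - block_op (\<lambda>x. block_index \<lfloor>x\<rfloor>) (profile (-1)) f) x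
      = (of_real a * ip f (unit_ind (- 1 - int n)) + of_real b * ip f (unit_ind n)) * profile 1 x
      - (of_real a * ip f (unit_ind (- 1 - int n)) - of_real b * ip f (unit_ind n)) * profile (-1) x"
    by (simp add: block_op_def n_def[symmetric])
  \<comment> \<open>On the negative half both profiles equal \<open>a\<close>, so the product with
    \<open>unit_ind (- 1 - int n)\<close> cancels; on the positive half they have opposite signs, so
    the product with \<open>unit_ind n\<close> cancels. Each time only the product with the mirror
    interval survives.\<close>
  also have "\<dots> = of_real (2 * a * b) * ip f (unit_ind (- 1 - \<lfloor>x\<rfloor>))"
  proof (cases "x < 0")
    case True
    then have n: "- 1 - \<lfloor>x\<rfloor> = int n" by (simp add: n_def block_index_def)
    have "profile s x = of_real a" for s
      using True by (simp add: profile_def Let_def n_def a_def)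
    then show ?thesis unfolding n by (simp add: algebra_simps)
  next
    case False
    then have n: "\<lfloor>x\<rfloor> = int n" by (simp add: n_def block_index_def)
    have "profile s x = of_real (s * b)" for s
      using False by (simp add: profile_def Let_def n_def b_def)
    then show ?thesis unfolding n by (simp add: algebra_simps)
  qed
  finally show ?thesis unfolding ab .
qed

text \<open>Reflection at 0 preserves Lebesgue measure and sends the floor to
  \<open>- 1 - \<lfloor>x\<rfloor>\<close> off the integers, a null set.\<close>

lemma integral_floor_reflect:
  fixes G :: "int \<Rightarrow> complex"
  shows "(LINT x::real|lebesgue. G \<lfloor>x\<rfloor>) = (LINT x::real|lebesgue. G (- 1 - \<lfloor>x\<rfloor>))"
proof -
  have "(LINT x::real|lebesgue. G \<lfloor>x\<rfloor>) = (LINT x::real|lebesgue. G \<lfloor>- x\<rfloor>)"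
    using lebesgue_integral_real_affine[of "-1" "\<lambda>x. G \<lfloor>x\<rfloor>" 0] by simp
  also have "\<dots> = (LINT x::real|lebesgue. G (- 1 - \<lfloor>x\<rfloor>))"
  proof (rule integral_cong_AE)
    show "AE x::real in lebesgue. G \<lfloor>- x\<rfloor> = G (- 1 - \<lfloor>x\<rfloor>)"
    proof (rule AE_I')
      show "(\<int> :: real set) \<in> null_sets lebesgue"
        by (intro null_sets_completionI countable_imp_null_set_lborel countable_int)
      have "\<lfloor>- x\<rfloor> = - 1 - \<lfloor>x\<rfloor>" if "x \<notin> \<int>" for x :: real
      proof -
        have "x \<noteq> of_int \<lfloor>x\<rfloor>" using that by (metis Ints_of_int)
        then show ?thesis using ceiling_altdef[of x] by (simp add: ceiling_def)
      qed
      then show "{x \<in> space lebesgue. G \<lfloor>- x\<rfloor> \<noteq> G (- 1 - \<lfloor>x\<rfloor>)} \<subseteq> (\<int> :: real set)"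
        by (metis (mono_tags, lifting) mem_Collect_eq subsetI)
    qed
    have "(\<lambda>x::real. \<lfloor>- x\<rfloor>) \<in> measurable lebesgue (count_space UNIV)"
      by (rule measurable_completion) simp
    then show "(\<lambda>x::real. G \<lfloor>- x\<rfloor>) \<in> borel_measurable lebesgue"
      by (rule measurable_compose) simp
    show "(\<lambda>x::real. G (- 1 - \<lfloor>x\<rfloor>)) \<in> borel_measurable lebesgue"
      by (rule borel_measurable_floor_lebesgue[of "\<lambda>k. G (- 1 - k)"])
  qed
  finally show ?thesis .
qed

text \<open>Every eigenvector \<open>unit_ind n\<close> forces a trace of at least
  \<open>2 * exp (- n) * exp n = 2\<close> in its block, so the sum over the blocks
  diverges.\<close>

lemma not_in_Mplus:
  assumes "positive_op A"
    and eig: "\<And>n. AE x in lebesgue. A (unit_ind (int n)) x = of_real (abs_weight (int n)) * unit_ind (int n) x"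
  shows "\<not> in_Mplus A"
proof
  assume "in_Mplus A"
  then have fin: "psi A < \<infinity>" by (simp add: in_Mplus_def)
  have "ennreal 2 \<le> trace_pos (sqrtDE (Suc n) \<circ> A \<circ> sqrtDE (Suc n))" for n
  proof -
    \<comment> \<open>On the support of \<open>unit_ind n\<close> the multiplier
      \<open>exp (x / 2)\<close> is at least its value at the left endpoint.\<close>
    have "l2norm (\<lambda>x. of_real (exp (real n / 2)) * unit_ind n x) \<le> l2norm (sqrtDE (Suc n) (unit_ind n))"
    proof (intro l2norm_mono sq_int_scale sq_int_sqrtDE sq_int_unit_ind)
      show "cmod (of_real (exp (real n / 2)) * unit_ind n x) \<le> cmod (sqrtDE (Suc n) (unit_ind n) x)" for x
        by (auto simp: unit_ind_apply sqrtDE_def floor_eq_iff Kset_def indicator_def norm_mult)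
    qed
    moreover have "l2norm (unit_ind n) = 1"
      using ip_unit_ind[of n n] unfolding ip_self
      by (metis abs_of_nonneg l2norm_nonneg of_real_eq_1_iff power2_eq_1_iff abs_1 abs_minus)
    ultimately have "exp (real n / 2) \<le> l2norm (sqrtDE (Suc n) (unit_ind n))"
      unfolding l2norm_scale by simp
    then have "(exp (real n / 2))\<^sup>2 \<le> (l2norm (sqrtDE (Suc n) (unit_ind n)))\<^sup>2"
      by (rule power_mono) simp
    then have "abs_weight n * (exp (real n / 2))\<^sup>2 \<le> abs_weight n * (l2norm (sqrtDE (Suc n) (unit_ind n)))\<^sup>2"
      using abs_weight_pos[of n] by simp
    also have "abs_weight n * (exp (real n / 2))\<^sup>2 = 2"
      by (simp add: abs_weight_def block_index_def exp_add[symmetric] flip: exp_double)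
    finally have "ennreal 2 \<le> ennreal (abs_weight n * (l2norm (sqrtDE (Suc n) (unit_ind n)))\<^sup>2)"
      by (rule ennreal_leI)
    also have "\<dots> \<le> trace_pos (sqrtDE (Suc n) \<circ> A \<circ> sqrtDE (Suc n))"
      by (intro trace_sqrtDE_ge positive_op_ge_eigenprojection assms sq_int_unit_ind less_imp_le[OF abs_weight_pos])
        (simp_all add: ip_unit_ind)
    finally show ?thesis .
  qed
  then have "(\<Sum>n::nat. ennreal 2) \<le> psi A"
    unfolding psi_def by (intro suminf_le) auto
  with fin have "(\<Sum>n::nat. ennreal 2) \<noteq> \<infinity>" by auto
  then have "summable (\<lambda>n::nat. 2::real)"
    by (intro summable_suminf_not_top) auto
  then show False by (simp add: summable_const_iff)
qed

text \<open>An absolute value is fixed by \<open>is_abs_op\<close> through inner products, hence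
  only up to null sets. The claim is therefore made for all of them, and the existence clause keeps
  it from being vacuous.\<close>

theorem theorem8p9:
  shows "\<exists>S T. positive_op S \<and> compact_op S \<and> positive_op T \<and> compact_op T \<and>
     in_Mplus S \<and> in_Mplus T \<and>
     (\<exists>A. is_abs_op A (\<lambda>f. S f - T f)) \<and>
     (\<forall>A. is_abs_op A (\<lambda>f. S f - T f) \<longrightarrow> \<not> in_Mplus A)"
proof -
  define S where "S = block_op (\<lambda>x. block_index \<lfloor>x\<rfloor>) (profile 1)"
  define T where "T = block_op (\<lambda>x. block_index \<lfloor>x\<rfloor>) (profile (-1))"
  interpret S: block_operator "\<lambda>x. block_index \<lfloor>x\<rfloor>" "profile 1"
    by (rule block_operator_profile) simp
  interpret T: block_operator "\<lambda>x. block_index \<lfloor>x\<rfloor>" "profile (-1)"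
    by (rule block_operator_profile) simp
  interpret A: block_operator "\<lambda>x. int_encode \<lfloor>x\<rfloor>" abs_profile
    by (rule block_operator_abs_profile)
  have S: "positive_op S" "compact_op S" "in_Mplus S"
    unfolding in_Mplus_def S_def
    using S.positive_block_op S.compact_block_op psi_profile_finite[of 1] by auto
  have T: "positive_op T" "compact_op T" "in_Mplus T"
    unfolding in_Mplus_def T_def
    using T.positive_block_op T.compact_block_op psi_profile_finite[of "-1"] by auto
  \<comment> \<open>Both sides are integrals of a function of the floor, and they differ exactly by
    the reflection of the cells.\<close>
  have abs_sq: "ip (abs_op (abs_op f)) g = ip (S f - T f) (S g - T g)" if f: "sq_int f" and g: "sq_int g" for f g
  proof -
    define G where "G k = of_real ((abs_weight k)\<^sup>2) * (ip f (unit_ind k) * cnj (ip g (unit_ind k)))" for k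
    have "ip (abs_op (abs_op f)) g = ip (abs_op f) (abs_op g)"
      by (intro A.hermitian_block_op A.sq_int_block_op f g)
    also have "\<dots> = (LINT x::real|lebesgue. G \<lfloor>x\<rfloor>)"
      unfolding ip_def[of "abs_op f"] abs_op_apply G_def
      by (rule Bochner_Integration.integral_cong) (auto simp: power2_eq_square)
    also have "\<dots> = (LINT x::real|lebesgue. G (- 1 - \<lfloor>x\<rfloor>))"
      by (rule integral_floor_reflect)
    also have "\<dots> = (LINT x|lebesgue. (S f - T f) x * cnj ((S g - T g) x))"
      unfolding S_def T_def block_op_profile_diff[OF f] block_op_profile_diff[OF g] G_def
      by (rule Bochner_Integration.integral_cong) (auto simp: power2_eq_square abs_weight_def)
    also have "\<dots> = ip (S f - T f) (S g - T g)"
      by (rule ip_def[symmetric])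
    finally show ?thesis .
  qed
  have "is_abs_op abs_op (\<lambda>f. S f - T f)"
    unfolding is_abs_op_def using A.positive_block_op abs_sq by blast
  moreover have "\<not> in_Mplus B" if B: "is_abs_op B (\<lambda>f. S f - T f)" for B
  proof (rule not_in_Mplus)
    show posB: "positive_op B" using B by (simp add: is_abs_op_def)
    fix n :: nat
    define u where "u = unit_ind (int n)"
    define w where "w = abs_weight (int n)"
    have u: "sq_int u" unfolding u_def by (rule sq_int_unit_ind)
    have ip_u: "ip u (unit_ind k) = (if k = int n then 1 else 0)" for k
      by (auto simp: u_def ip_unit_ind)
    have u_apply: "u x = (if \<lfloor>x\<rfloor> = int n then 1 else 0)" for x
      by (simp add: u_def unit_ind_apply)
    have eig: "abs_op u = (\<lambda>x. of_real w * u x)"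
      by (rule ext) (auto simp: abs_op_apply w_def ip_u u_apply)
    have eig2: "abs_op (abs_op u) = (\<lambda>x. of_real (w\<^sup>2) * u x)"
    proof
      fix x
      have "abs_op (\<lambda>x. of_real w * u x) x = of_real (abs_weight \<lfloor>x\<rfloor>) * (of_real w * ip u (unit_ind \<lfloor>x\<rfloor>))"
        by (simp only: abs_op_apply ip_scale_left)
      then show "abs_op (abs_op u) x = of_real (w\<^sup>2) * u x"
        unfolding eig ip_u u_apply[of x] by (auto simp: w_def power2_eq_square)
    qed
    \<comment> \<open>The squares of \<open>B\<close> and of \<open>abs_op\<close> have the same
      inner products, both being given by \<open>S - T\<close>; testing their values at
      \<open>u\<close> against this defect \<open>y\<close> itself shows that it vanishes.\<close>
    define y where "y = (\<lambda>x. B (B u) x - of_real (w\<^sup>2) * u x)"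
    note sB = positive_op_sq_int[OF posB]
    have y: "sq_int y" unfolding y_def by (intro sq_int_diff sq_int_scale sB u)
    have "ip (B (B u)) y = ip (abs_op (abs_op u)) y"
      using B u y abs_sq by (simp add: is_abs_op_def)
    then have "ip y y = 0"
      by (subst (1) y_def, subst ip_diff_left) (auto simp: eig2 intro!: sB u y sq_int_scale)
    then have "l2norm y = 0" by (simp add: ip_self)
    then have "AE x in lebesgue. y x = 0" using l2norm_eq_0_iff[OF y] by simp
    then have "AE x in lebesgue. B (B u) x = of_real (w\<^sup>2) * u x"
      by eventually_elim (simp add: y_def)
    then have "AE x in lebesgue. B u x = of_real w * u x"
      by (rule positive_op_sqrt_eigenvector[OF posB u, rotated]) (simp add: w_def abs_weight_pos)
    then show "AE x in lebesgue. B (unit_ind (int n)) x = of_real (abs_weight (int n)) * unit_ind (int n) x"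
      by (simp only: u_def w_def)
  qed
  ultimately show ?thesis using S T by blast
qed

end
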